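(* For every $r\in[0,1]$, there exist $2\times 2$ Hadamard unitaries $u$ and $v$ such that $\mathrm{d}_{\mathrm{MT}}(\mathscr{R}_u,\mathscr{R}_v)=r$.
   Context: Let $n\ge 2$ (here $n=2$); $\mathbb{M}_n$ is the algebra of $n\times n$ complex matrices with matrix units $E_{ij}$ and identity $\mathbb{I}_n$, and $\Delta\subset \mathbb{M}_n$ is the algebra of diagonal matrices. A Hadamard unitary in $\mathbb{M}_n$ is a unitary matrix all of whose entries have modulus $n^{-1/2}$. Ambient factor: $\mathscr{R}$ is the hyperfinite $\mathrm{II}_1$-factor obtained as the weak closure, in the GNS representation of the unique normalized trace $\tau$, of $\bigcup_k \mathbb{M}_n^{\otimes k}$, where $\mathbb{M}_n^{\otimes k}\subset\mathbb{M}_n^{\otimes(k+1)}$ via $x\mapsto x\otimes \mathbb{I}_n$. Spin model subfactor: for a Hadamard unitary $u=(u_{ij})\in\mathbb{M}_n$ put $D_u:=\sqrt n\sum_{i,j}\overline{u_{ij}}\,(E_{jj}\otimes E_{ii})$, $u_1:=(u\otimes \mathbb{I}_n)D_u\in\mathbb{M}_n\otimes\Delta$, and for $k\ge1$, $u_{2k-1}:=\prod_{i=0}^{k-1}\big(\mathbb{I}_n^{\otimes i}\otimes u_1\otimes \mathbb{I}_n^{\otimes (k-1-i)}\big)\in\mathbb{M}_n^{\otimes (k+1)}$ (factors ordered from left to right with increasing $i$). The algebras $u_{2k-1}(\mathbb{M}_n^{\otimes k}\otimes \mathbb{I}_n)u_{2k-1}^*$ increase with $k$, and $\mathscr{R}_u\subset\mathscr{R}$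 is the weak closure of their union. Mashood–Taylor distance: for von Neumann subalgebras $P,Q$ of $(M,\tau)$, $\mathrm{d}_{\mathrm{MT}}(P,Q)$ is the Hausdorff distance, with respect to $\|x\|_\tau=\tau(x^*x)^{1/2}$, between the operator-norm closed unit balls of $P$ and $Q$. *)

theory Defs
  imports "HOL-Analysis.Analysis" "HOL-Library.Numeral_Type"
begin

section \<open>The algebra \<open>\<Union>k. M\<^sub>n\<^sup>\<otimes>\<^sup>k\<close>\<close>

text \<open>
  Here \<open>n = CARD('n)\<close>.  A matrix \<open>m\<close> in the \<open>k\<close>-th tensor power of \<open>M\<^sub>n\<close> is indexed by the words of
  length \<open>k\<close> over \<open>'n\<close>.  In order that the embedding \<open>x \<mapsto> x \<otimes> I\<close> becomes a literal inclusion, \<open>m\<close>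
  is stored as the infinite matrix \<open>m \<otimes> I \<otimes> I \<otimes> \<dots>\<close>, indexed by infinite words.
\<close>

definition words :: "nat \<Rightarrow> 'n::finite list set"
  where "words k = {w. length w = k}"

definition kern ::
    "nat \<Rightarrow> ('n::finite list \<Rightarrow> 'n list \<Rightarrow> complex) \<Rightarrow> (nat \<Rightarrow> 'n) \<Rightarrow> (nat \<Rightarrow> 'n) \<Rightarrow> complex"
  where "kern k m = (\<lambda>s t. if \<forall>i\<ge>k. s i = t i then m (map s [0..<k]) (map t [0..<k]) else 0)"

typedef (overloaded) 'n tensor_alg =
    "(\<Union>k. range (kern k)) :: ((nat \<Rightarrow> 'n::finite) \<Rightarrow> (nat \<Rightarrow> 'n) \<Rightarrow> complex) set"
  by blast

setup_lifting type_definition_tensor_alg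

lift_definition of_mat :: "nat \<Rightarrow> ('n::finite list \<Rightarrow> 'n list \<Rightarrow> complex) \<Rightarrow> 'n tensor_alg"
  is kern by blast

text \<open>The subalgebra \<open>M\<^sub>n\<^sup>\<otimes>\<^sup>k\<close>.\<close>

definition level :: "nat \<Rightarrow> 'n::finite tensor_alg set"
  where "level k = range (of_mat k)"

lemma finite_words [simp]: "finite (words k :: 'n::finite list set)"
  using finite_lists_length_eq[of "UNIV :: 'n set" k] by (simp add: words_def)

lemma card_words: "card (words k :: 'n::finite list set) = CARD('n) ^ k"
  using card_lists_length_eq[of "UNIV :: 'n set" k] by (simp add: words_def)

lemma words_0: "words 0 = {[]}"
  by (auto simp: words_def)

lemma sum_words_Suc:
  "(\<Sum>w\<in>words (Suc k). f w) = (\<Sum>w\<in>words k. \<Sum>a\<in>(UNIV::'n::finite set). f (w @ [a]))"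
proof -
  have "(\<Sum>w\<in>words k. \<Sum>a\<in>(UNIV::'n set). f (w @ [a])) = (\<Sum>(w, a)\<in>words k \<times> UNIV. f (w @ [a]))"
    by (simp add: sum.cartesian_product)
  also have "\<dots> = (\<Sum>w\<in>words (Suc k). f w)"
    by (rule sum.reindex_bij_witness[where j = "\<lambda>(w, a). w @ [a]" and i = "\<lambda>w. (butlast w, last w)"])
       (auto simp: words_def intro!: append_butlast_last_id)
  finally show ?thesis by simp
qed

definition raise :: "('n list \<Rightarrow> 'n list \<Rightarrow> complex) \<Rightarrow> 'n list \<Rightarrow> 'n list \<Rightarrow> complex"
  where "raise m v w = (if last v = last w then m (butlast v) (butlast w) else 0)"

lemma kern_raise: "kern k m = kern (Suc k) (raise m)"
proof (intro ext)
  fix s t :: "nat \<Rightarrow> 'a"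
  have "(\<forall>i\<ge>k. s i = t i) \<longleftrightarrow> (\<forall>i\<ge>Suc k. s i = t i) \<and> s k = t k"
    by (auto simp: le_Suc_eq) (metis le_antisym not_less_eq_eq)
  then show "kern k m s t = kern (Suc k) (raise m) s t"
    by (auto simp: kern_def raise_def)
qed

lemma of_mat_raise: "of_mat k m = of_mat (Suc k) (raise m)"
  by transfer (rule kern_raise)

lemma of_mat_lift: "k \<le> l \<Longrightarrow> \<exists>m'. of_mat k m = of_mat l m'"
proof (induction l rule: dec_induct)
  case (step l)
  then obtain m' where "of_mat k m = of_mat l m'" by blast
  also have "\<dots> = of_mat (Suc l) (raise m')" by (rule of_mat_raise)
  finally show ?case by blast
qed blast

lemma level_mono: "k \<le> l \<Longrightarrow> level k \<subseteq> level l"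
  using of_mat_lift unfolding level_def by blast

lemma ex_of_mat: "\<exists>k m. x = of_mat k m"
  by transfer blast

lemma ex_of_mat2: "\<exists>k m m'. x = of_mat k m \<and> y = of_mat k m'"
proof -
  obtain k m where x: "x = of_mat k m" using ex_of_mat by blast
  obtain l m' where y: "y = of_mat l m'" using ex_of_mat by blast
  show ?thesis
    using of_mat_lift[of k "max k l" m] of_mat_lift[of l "max k l" m'] x y by auto
qed

lemma ex_of_mat3: "\<exists>k m m' m''. x = of_mat k m \<and> y = of_mat k m' \<and> z = of_mat k m''"
proof -
  obtain k m m' where x: "x = of_mat k m" "y = of_mat k m'" using ex_of_mat2 by blast
  obtain l m'' where z: "z = of_mat l m''" using ex_of_mat by blast
  show ?thesis
    using of_mat_lift[of k "max k l" m] of_mat_lift[of k "max k l" m']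
      of_mat_lift[of l "max k l" m''] x z by auto
qed

lemma kern_eq_iff: "kern k m = kern k m' \<longleftrightarrow> (\<forall>v\<in>words k. \<forall>w\<in>words k. m v w = m' v w)"
proof
  assume eq: "kern k m = kern k m'"
  show "\<forall>v\<in>words k. \<forall>w\<in>words k. m v w = m' v w"
  proof (intro ballI)
    fix v w :: "'a list" assume vw: "v \<in> words k" "w \<in> words k"
    let ?e = "\<lambda>(v::'a list) i. if i < k then v ! i else undefined"
    have "map (?e v) [0..<k] = v" "map (?e w) [0..<k] = w"
      using vw by (auto simp: words_def intro: nth_equalityI)
    then show "m v w = m' v w"
      using fun_cong[OF fun_cong[OF eq, of "?e v"], of "?e w"] by (simp add: kern_def)
  qed
qed (auto simp: kern_def words_def fun_eq_iff)

lemma of_mat_eq_iff: "of_mat k m = of_mat k m' \<longleftrightarrow> (\<forall>v\<in>words k. \<forall>w\<in>words k. m v w = m' v w)"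
  by transfer (rule kern_eq_iff)

text \<open>The product of infinite matrices; each row of \<open>kern k m\<close> has finitely many nonzero entries.\<close>

definition kmult ::
    "('a \<Rightarrow> 'a \<Rightarrow> complex) \<Rightarrow> ('a \<Rightarrow> 'a \<Rightarrow> complex) \<Rightarrow> 'a \<Rightarrow> 'a \<Rightarrow> complex"
  where "kmult x y = (\<lambda>s t. \<Sum>r | x s r \<noteq> 0. x s r * y r t)"

definition mmult ::
    "nat \<Rightarrow> ('n::finite list \<Rightarrow> 'n list \<Rightarrow> complex) \<Rightarrow> ('n list \<Rightarrow> 'n list \<Rightarrow> complex) \<Rightarrow>
      'n list \<Rightarrow> 'n list \<Rightarrow> complex"
  where "mmult k m m' = (\<lambda>v w. \<Sum>u\<in>words k. m v u * m' u w)"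

lemma kmult_kern: "kmult (kern k m) (kern k m') = kern k (mmult k m m')"
proof (intro ext)
  fix s t :: "nat \<Rightarrow> 'a"
  define N where "N = {r. \<forall>i\<ge>k. s i = r i}"
  define e where "e = (\<lambda>(u::'a list) i. if i < k then u ! i else s i)"
  have eN: "bij_betw e (words k) N"
    by (rule bij_betw_byWitness[where f' = "\<lambda>r. map r [0..<k]"])
       (auto simp: e_def N_def words_def fun_eq_iff intro: nth_equalityI)
  have me: "map (e u) [0..<k] = u" if "u \<in> words k" for u
    using that by (auto simp: words_def e_def intro: nth_equalityI)
  have finN: "finite N"
    using bij_betw_finite[OF eN] by simp
  have "kmult (kern k m) (kern k m') s t = (\<Sum>r\<in>N. kern k m s r * kern k m' r t)"
    unfolding kmult_def
    by (rule sum.mono_neutral_left) (use finN in \<open>auto simp: N_def kern_def\<close>)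
  also have "\<dots> = (\<Sum>u\<in>words k. kern k m s (e u) * kern k m' (e u) t)"
    by (rule sum.reindex_bij_betw[OF eN, symmetric])
  also have "\<dots> = kern k (mmult k m m') s t"
  proof (cases "\<forall>i\<ge>k. s i = t i")
    case True
    have "kern k m s (e u) * kern k m' (e u) t = m (map s [0..<k]) u * m' u (map t [0..<k])"
      if "u \<in> words k" for u
      using True me[OF that] by (simp add: kern_def) (auto simp: e_def)
    then show ?thesis
      using True by (simp add: kern_def mmult_def)
  next
    case False
    then have "kern k m' (e u) t = 0" for u
      by (auto simp: kern_def e_def)
    then show ?thesis
      using False by (auto simp: kern_def)
  qed
  finally show "kmult (kern k m) (kern k m') s t = kern k (mmult k m m') s t" .
qed

lemma ex_kern2:
  assumes "x \<in> (\<Union>k. range (kern k))" "y \<in> (\<Union>k. range (kern k))"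
  shows "\<exists>k m m'. x = kern k m \<and> y = kern k m'"
proof -
  have "\<exists>k m m'. Abs_tensor_alg x = of_mat k m \<and> Abs_tensor_alg y = of_mat k m'"
    by (rule ex_of_mat2)
  then show ?thesis
    using assms by (metis Abs_tensor_alg_inverse of_mat.rep_eq)
qed

instantiation tensor_alg :: (finite) ring_1
begin

lift_definition zero_tensor_alg :: "'a tensor_alg" is "\<lambda>s t. 0"
  by (rule UN_I[of 0], simp, rule range_eqI[of _ _ "\<lambda>_ _. 0"]) (auto simp: kern_def fun_eq_iff)

lift_definition one_tensor_alg :: "'a tensor_alg" is "\<lambda>s t. if s = t then 1 else 0"
  by (rule UN_I[of 0], simp, rule range_eqI[of _ _ "\<lambda>_ _. 1"]) (auto simp: kern_def fun_eq_iff)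

lift_definition plus_tensor_alg :: "'a tensor_alg \<Rightarrow> 'a tensor_alg \<Rightarrow> 'a tensor_alg"
  is "\<lambda>x y s t. x s t + y s t"
proof -
  fix x y :: "(nat \<Rightarrow> 'a) \<Rightarrow> (nat \<Rightarrow> 'a) \<Rightarrow> complex"
  assume "x \<in> (\<Union>k. range (kern k))" "y \<in> (\<Union>k. range (kern k))"
  then obtain k m m' where "x = kern k m" "y = kern k m'" using ex_kern2 by blast
  then have "(\<lambda>s t. x s t + y s t) = kern k (\<lambda>v w. m v w + m' v w)"
    by (intro ext) (auto simp: kern_def)
  then show "(\<lambda>s t. x s t + y s t) \<in> (\<Union>k. range (kern k))" by blast
qed

lift_definition minus_tensor_alg :: "'a tensor_alg \<Rightarrow> 'a tensor_alg \<Rightarrow> 'a tensor_alg"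
  is "\<lambda>x y s t. x s t - y s t"
proof -
  fix x y :: "(nat \<Rightarrow> 'a) \<Rightarrow> (nat \<Rightarrow> 'a) \<Rightarrow> complex"
  assume "x \<in> (\<Union>k. range (kern k))" "y \<in> (\<Union>k. range (kern k))"
  then obtain k m m' where "x = kern k m" "y = kern k m'" using ex_kern2 by blast
  then have "(\<lambda>s t. x s t - y s t) = kern k (\<lambda>v w. m v w - m' v w)"
    by (intro ext) (auto simp: kern_def)
  then show "(\<lambda>s t. x s t - y s t) \<in> (\<Union>k. range (kern k))" by blast
qed

lift_definition uminus_tensor_alg :: "'a tensor_alg \<Rightarrow> 'a tensor_alg" is "\<lambda>x s t. - x s t"
proof -
  fix x :: "(nat \<Rightarrow> 'a) \<Rightarrow> (nat \<Rightarrow> 'a) \<Rightarrow> complex"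
  assume "x \<in> (\<Union>k. range (kern k))"
  then obtain k m where "x = kern k m" by blast
  then have "(\<lambda>s t. - x s t) = kern k (\<lambda>v w. - m v w)"
    by (intro ext) (auto simp: kern_def)
  then show "(\<lambda>s t. - x s t) \<in> (\<Union>k. range (kern k))" by blast
qed

lift_definition times_tensor_alg :: "'a tensor_alg \<Rightarrow> 'a tensor_alg \<Rightarrow> 'a tensor_alg" is kmult
proof -
  fix x y :: "(nat \<Rightarrow> 'a) \<Rightarrow> (nat \<Rightarrow> 'a) \<Rightarrow> complex"
  assume "x \<in> (\<Union>k. range (kern k))" "y \<in> (\<Union>k. range (kern k))"
  then obtain k m m' where "x = kern k m" "y = kern k m'" using ex_kern2 by blast
  then show "kmult x y \<in> (\<Union>k. range (kern k))" using kmult_kern by blast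
qed

lemma of_mat_mult: "of_mat k m * of_mat k m' = of_mat k (mmult k m m')"
  by transfer (rule kmult_kern)

lemma of_mat_add: "of_mat k m + of_mat k m' = of_mat k (\<lambda>v w. m v w + m' v w)"
  by transfer (intro ext, auto simp: kern_def)

lemma of_mat_minus: "of_mat k m - of_mat k m' = of_mat k (\<lambda>v w. m v w - m' v w)"
  by transfer (intro ext, auto simp: kern_def)

lemma of_mat_uminus: "- of_mat k m = of_mat k (\<lambda>v w. - m v w)"
  by transfer (intro ext, auto simp: kern_def)

lemma of_mat_zero: "0 = of_mat k (\<lambda>v w. 0)"
  by transfer (intro ext, auto simp: kern_def)

lemma of_mat_one: "1 = of_mat k (\<lambda>v w. if v = w then 1 else 0)"
proof transfer
  fix k
  show "(\<lambda>s t. if s = t then 1 else 0) = kern k (\<lambda>v w. if v = (w :: 'a list) then 1 else 0)"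
  proof (intro ext)
    fix s t :: "nat \<Rightarrow> 'a"
    have "s i = t i" if "\<forall>i\<ge>k. s i = t i" "map s [0..<k] = map t [0..<k]" for i
      using that by (cases "i < k") auto
    then have "(s = t) = ((\<forall>i\<ge>k. s i = t i) \<and> map s [0..<k] = map t [0..<k])"
      by blast
    then show "(if s = t then 1 else 0) = kern k (\<lambda>v w. if v = w then 1 else 0) s t"
      by (auto simp: kern_def)
  qed
qed

instance
proof
  fix a b c :: "'a tensor_alg"
  obtain k m m' m'' where abc: "a = of_mat k m" "b = of_mat k m'" "c = of_mat k m''"
    using ex_of_mat3 by metis
  show "a * b * c = a * (b * c)"
  proof -
    have "mmult k (mmult k m m') m'' v w = mmult k m (mmult k m' m'') v w" for v w
      unfolding mmult_def sum_distrib_left sum_distrib_right mult.assoc by (rule sum.swap)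
    then have "mmult k (mmult k m m') m'' = mmult k m (mmult k m' m'')"
      by blast
    then show ?thesis by (simp add: abc of_mat_mult)
  qed
  show "1 * a = a" "a * 1 = a"
    unfolding abc of_mat_one[of k] of_mat_mult of_mat_eq_iff
    by (simp_all add: mmult_def if_distrib[of "\<lambda>c. c * _"] if_distrib[of "\<lambda>c. _ * c"]
        cong: if_cong)
  show "(a + b) * c = a * c + b * c" "a * (b + c) = a * b + a * c"
    unfolding abc of_mat_mult of_mat_add
    by (simp_all add: mmult_def algebra_simps sum.distrib)
  show "(0 :: 'a tensor_alg) \<noteq> 1"
    by transfer (auto simp: fun_eq_iff)
  show "a + b + c = a + (b + c)" "a + b = b + a" "0 + a = a" "- a + a = 0" "a - b = a + - b"
    by (transfer, simp add: fun_eq_iff)+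
qed

end

lift_definition cscale :: "complex \<Rightarrow> 'n::finite tensor_alg \<Rightarrow> 'n tensor_alg"
  is "\<lambda>c x s t. c * x s t"
proof -
  fix c :: complex and x :: "(nat \<Rightarrow> 'n) \<Rightarrow> (nat \<Rightarrow> 'n) \<Rightarrow> complex"
  assume "x \<in> (\<Union>k. range (kern k))"
  then obtain k m where "x = kern k m" by blast
  then have "(\<lambda>s t. c * x s t) = kern k (\<lambda>v w. c * m v w)"
    by (intro ext) (auto simp: kern_def)
  then show "(\<lambda>s t. c * x s t) \<in> (\<Union>k. range (kern k))" by blast
qed

lift_definition adj :: "'n::finite tensor_alg \<Rightarrow> 'n tensor_alg" is "\<lambda>x s t. cnj (x t s)"
proof -
  fix x :: "(nat \<Rightarrow> 'n) \<Rightarrow> (nat \<Rightarrow> 'n) \<Rightarrow> complex"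
  assume "x \<in> (\<Union>k. range (kern k))"
  then obtain k m where "x = kern k m" by blast
  then have "(\<lambda>s t. cnj (x t s)) = kern k (\<lambda>v w. cnj (m w v))"
    by (intro ext) (auto simp: kern_def)
  then show "(\<lambda>s t. cnj (x t s)) \<in> (\<Union>k. range (kern k))" by blast
qed

lemma of_mat_cscale: "cscale c (of_mat k m) = of_mat k (\<lambda>v w. c * m v w)"
  by transfer (intro ext, auto simp: kern_def)

lemma of_mat_adj: "adj (of_mat k m) = of_mat k (\<lambda>v w. cnj (m w v))"
  by transfer (intro ext, auto simp: kern_def)

lemma adj_mult: "adj (x * y) = adj y * adj x"
proof -
  obtain k m m' where "x = of_mat k m" "y = of_mat k m'" using ex_of_mat2 by blast
  then show ?thesis
    by (simp add: of_mat_mult of_mat_adj mmult_def mult.commute)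
qed

lemma adj_adj [simp]: "adj (adj x) = x"
  by transfer simp

lemma adj_add: "adj (x + y) = adj x + adj y"
  by transfer simp

lemma adj_cscale: "adj (cscale c x) = cscale (cnj c) (adj x)"
  by transfer simp

lemma cscale_mult_left: "cscale c x * y = cscale c (x * y)"
  and cscale_mult_right: "x * cscale c y = cscale c (x * y)"
proof -
  obtain k m m' where "x = of_mat k m" "y = of_mat k m'" using ex_of_mat2 by blast
  then show "cscale c x * y = cscale c (x * y)" "x * cscale c y = cscale c (x * y)"
    by (simp_all add: of_mat_mult of_mat_cscale mmult_def sum_distrib_left mult_ac)
qed

lemma cscale_add: "cscale c (x + y) = cscale c x + cscale c y"
  by transfer (simp add: algebra_simps)


section \<open>The normalized trace and the GNS representation\<close>

definition mtr :: "nat \<Rightarrow> ('n::finite list \<Rightarrow> 'n list \<Rightarrow> complex) \<Rightarrow> complex"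
  where "mtr k m = (\<Sum>w\<in>words k. m w w) / of_nat (CARD('n) ^ k)"

definition trc :: "'n::finite tensor_alg \<Rightarrow> complex"
  where "trc x = (THE c. \<exists>k m. x = of_mat k m \<and> c = mtr k m)"

lemma mtr_raise: "mtr (Suc k) (raise m) = mtr k (m :: 'n::finite list \<Rightarrow> _)"
  by (simp add: mtr_def sum_words_Suc raise_def sum_distrib_left [symmetric])

lemma mtr_lift: "k \<le> l \<Longrightarrow> \<exists>m'. of_mat k m = of_mat l m' \<and> mtr k m = mtr l m'"
proof (induction l rule: dec_induct)
  case (step l)
  then obtain m' where "of_mat k m = of_mat l m'" "mtr k m = mtr l m'" by blast
  then have "of_mat k m = of_mat (Suc l) (raise m') \<and> mtr k m = mtr (Suc l) (raise m')"
    by (simp add: mtr_raise flip: of_mat_raise)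
  then show ?case by blast
qed blast

lemma mtr_cong: "of_mat k m = of_mat k m' \<Longrightarrow> mtr k m = mtr k m'"
  by (auto simp: of_mat_eq_iff mtr_def)

lemma trc_of_mat: "trc (of_mat k m) = mtr k m"
  unfolding trc_def
proof (rule the_equality)
  fix c assume "\<exists>l m'. of_mat k m = of_mat l m' \<and> c = mtr l m'"
  then obtain l m' where *: "of_mat k m = of_mat l m'" "c = mtr l m'" by blast
  obtain p where p: "of_mat k m = of_mat (max k l) p" "mtr k m = mtr (max k l) p"
    using mtr_lift[of k "max k l"] by (metis max.cobounded1)
  obtain q where q: "of_mat l m' = of_mat (max k l) q" "mtr l m' = mtr (max k l) q"
    using mtr_lift[of l "max k l"] by (metis max.cobounded2)
  show "c = mtr k m" using mtr_cong * p q by metis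
qed blast

lemma trc_add: "trc (x + y) = trc x + trc y"
proof -
  obtain k m m' where "x = of_mat k m" "y = of_mat k m'" using ex_of_mat2 by blast
  then show ?thesis
    by (simp add: of_mat_add trc_of_mat mtr_def sum.distrib add_divide_distrib)
qed

lemma trc_cscale: "trc (cscale c x) = c * trc x"
proof -
  obtain k m where "x = of_mat k m" using ex_of_mat by blast
  then show ?thesis
    by (simp add: of_mat_cscale trc_of_mat mtr_def sum_distrib_left)
qed

lemma trc_adj: "trc (adj x) = cnj (trc x)"
proof -
  obtain k m where "x = of_mat k m" using ex_of_mat by blast
  then show ?thesis
    by (simp add: of_mat_adj trc_of_mat mtr_def)
qed

lemma trc_mult_commute: "trc (x * y) = trc (y * x)"
proof -
  obtain k m m' where "x = of_mat k m" "y = of_mat k m'" using ex_of_mat2 by blast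
  moreover have "(\<Sum>w\<in>words k. \<Sum>u\<in>words k. m w u * m' u w)
      = (\<Sum>w\<in>words k. \<Sum>u\<in>words k. m' w u * m u w)"
    by (subst sum.swap) (simp add: mult.commute)
  ultimately show ?thesis
    by (simp add: of_mat_mult trc_of_mat mtr_def mmult_def)
qed

lemma trc_one: "trc (1 :: 'n::finite tensor_alg) = 1"
  by (simp add: of_mat_one[of 0] trc_of_mat mtr_def words_0)

definition sesq :: "'n::finite tensor_alg \<Rightarrow> 'n tensor_alg \<Rightarrow> complex"
  where "sesq x y = trc (adj y * x)"

lemma sesq_of_mat:
  "sesq (of_mat k m) (of_mat k (m' :: 'n::finite list \<Rightarrow> _))
    = (\<Sum>w\<in>words k. \<Sum>u\<in>words k. cnj (m' u w) * m u w) / of_nat (CARD('n) ^ k)"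
  by (simp add: sesq_def of_mat_adj of_mat_mult trc_of_mat mtr_def mmult_def)

lemma sesq_self:
  "sesq (of_mat k m) (of_mat k (m :: 'n::finite list \<Rightarrow> _))
    = of_real ((\<Sum>w\<in>words k. \<Sum>u\<in>words k. (cmod (m u w))\<^sup>2) / real (CARD('n) ^ k))"
proof -
  have "cnj z * z = of_real ((cmod z)\<^sup>2)" for z
    by (simp only: complex_norm_square mult.commute)
  then show ?thesis
    by (simp only: sesq_of_mat of_real_sum of_real_divide of_real_of_nat_eq)
qed

lemma sesq_add_left: "sesq (x + y) z = sesq x z + sesq y z"
  by (simp add: sesq_def distrib_left trc_add)

lemma sesq_cscale_left: "sesq (cscale c x) y = c * sesq x y"
  by (simp add: sesq_def cscale_mult_right trc_cscale)

lemma sesq_cscale_right: "sesq x (cscale c y) = cnj c * sesq x y"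
  by (simp add: sesq_def adj_cscale cscale_mult_left trc_cscale)

lemma sesq_commute: "sesq y x = cnj (sesq x y)"
  by (simp add: sesq_def trc_adj[symmetric] adj_mult)

lemma sesq_mult_left: "sesq (a * x) y = sesq x (adj a * y)"
  by (simp add: sesq_def adj_mult mult.assoc)

instantiation tensor_alg :: (finite) real_inner
begin

definition scaleR_tensor_alg :: "real \<Rightarrow> 'a tensor_alg \<Rightarrow> 'a tensor_alg"
  where "scaleR_tensor_alg r x = cscale (of_real r) x"

definition inner_tensor_alg :: "'a tensor_alg \<Rightarrow> 'a tensor_alg \<Rightarrow> real"
  where "inner_tensor_alg x y = Re (sesq x y)"

definition norm_tensor_alg :: "'a tensor_alg \<Rightarrow> real"
  where "norm_tensor_alg x = sqrt (inner x x)"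

definition sgn_tensor_alg :: "'a tensor_alg \<Rightarrow> 'a tensor_alg"
  where "sgn_tensor_alg x = inverse (norm x) *\<^sub>R x"

definition dist_tensor_alg :: "'a tensor_alg \<Rightarrow> 'a tensor_alg \<Rightarrow> real"
  where "dist_tensor_alg x y = norm (x - y)"

definition uniformity_tensor_alg :: "('a tensor_alg \<times> 'a tensor_alg) filter"
  where "uniformity_tensor_alg = (INF e\<in>{0 <..}. principal {(x, y). dist x y < e})"

definition open_tensor_alg :: "'a tensor_alg set \<Rightarrow> bool"
  where "open_tensor_alg U \<longleftrightarrow>
    (\<forall>x\<in>U. eventually (\<lambda>(x', y). x' = x \<longrightarrow> y \<in> U) uniformity)"

instance
proof
  fix x y z :: "'a tensor_alg" and a b :: real and U :: "'a tensor_alg set"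
  show "dist x y = norm (x - y)" by (rule dist_tensor_alg_def)
  show "sgn x = inverse (norm x) *\<^sub>R x" by (rule sgn_tensor_alg_def)
  show "uniformity = (INF e\<in>{0 <..}. principal {(x :: 'a tensor_alg, y). dist x y < e})"
    by (rule uniformity_tensor_alg_def)
  show "open U \<longleftrightarrow> (\<forall>x\<in>U. eventually (\<lambda>(x', y). x' = x \<longrightarrow> y \<in> U) uniformity)"
    by (rule open_tensor_alg_def)
  show "a *\<^sub>R (x + y) = a *\<^sub>R x + a *\<^sub>R y" "(a + b) *\<^sub>R x = a *\<^sub>R x + b *\<^sub>R x"
       "a *\<^sub>R b *\<^sub>R x = (a * b) *\<^sub>R x" "1 *\<^sub>R x = x"
    unfolding scaleR_tensor_alg_def by (transfer, simp add: algebra_simps)+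
  show "inner x y = inner y x"
    unfolding inner_tensor_alg_def by (subst sesq_commute) simp
  show "inner (x + y) z = inner x z + inner y z"
    by (simp add: inner_tensor_alg_def sesq_add_left)
  show "inner (a *\<^sub>R x) y = a * inner x y"
    by (simp add: inner_tensor_alg_def scaleR_tensor_alg_def sesq_cscale_left)
  obtain k m where x: "x = of_mat k m" using ex_of_mat by blast
  have *: "inner x x = (\<Sum>w\<in>words k. \<Sum>u\<in>words k. (cmod (m u w))\<^sup>2) / real (CARD('a) ^ k)"
    unfolding inner_tensor_alg_def x sesq_self by simp
  show "0 \<le> inner x x"
    unfolding * by (intro divide_nonneg_nonneg sum_nonneg) auto
  have "(\<Sum>w\<in>words k. \<Sum>u\<in>words k. (cmod (m u w))\<^sup>2) = 0
      \<longleftrightarrow> (\<forall>v\<in>words k. \<forall>w\<in>words k. m v w = 0)"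
    by (auto simp: sum_nonneg_eq_0_iff sum_nonneg)
  then show "inner x x = 0 \<longleftrightarrow> x = 0"
    unfolding * unfolding x of_mat_zero[of k] of_mat_eq_iff by simp
  show "norm x = sqrt (inner x x)" by (rule norm_tensor_alg_def)
qed

end

lemma inner_mult_left_adj: "inner (a * x) y = inner x (adj a * (y :: 'n::finite tensor_alg))"
  by (simp add: inner_tensor_alg_def sesq_mult_left)

lemma norm_cscale: "norm (cscale c x) = cmod c * norm (x :: 'n::finite tensor_alg)"
proof -
  have "sesq (cscale c x) (cscale c x) = c * cnj c * sesq x x"
    by (simp add: sesq_cscale_left sesq_cscale_right)
  also have "\<dots> = of_real ((cmod c)\<^sup>2) * sesq x x"
    by (simp only: complex_norm_square)
  finally have "inner (cscale c x) (cscale c x) = (cmod c)\<^sup>2 * inner x x"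
    by (simp add: inner_tensor_alg_def)
  then show ?thesis
    by (simp add: norm_eq_sqrt_inner real_sqrt_mult)
qed

lemma bounded_linear_cscale: "bounded_linear (cscale c :: 'n::finite tensor_alg \<Rightarrow> _)"
proof (rule bounded_linear_intro[where K = "cmod c"])
  show "cscale c (r *\<^sub>R x) = r *\<^sub>R cscale c x" for r and x :: "'n tensor_alg"
    unfolding scaleR_tensor_alg_def by transfer (simp add: mult_ac)
qed (auto simp: cscale_add norm_cscale mult.commute)

definition ematrix :: "'n list \<Rightarrow> 'n list \<Rightarrow> 'n list \<Rightarrow> 'n list \<Rightarrow> complex"
  where "ematrix a b = (\<lambda>v w. if v = a \<and> w = b then 1 else 0)"

lemma norm_ematrix_mult:
  assumes "a \<in> words k" "b \<in> words k"
  shows "norm (of_mat k (ematrix a b) * x) \<le> norm (x :: 'n::finite tensor_alg)"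
proof -
  define e where "e = of_mat k (ematrix a b)"
  define p where "p = of_mat k (ematrix b b)"
  have delta: "(\<Sum>u\<in>words k. (if u = c \<and> P then 1 else 0) * g u) = (if P then g c else 0)"
    if "c \<in> words k" for c :: "'n list" and P and g :: "'n list \<Rightarrow> complex"
  proof -
    have "(\<Sum>u\<in>words k. (if u = c \<and> P then 1 else 0) * g u)
        = (\<Sum>u\<in>words k. if u = c then (if P then g u else 0) else 0)"
      by (rule sum.cong) auto
    then show ?thesis using that by simp
  qed
  have adj_e: "adj (of_mat k (ematrix c d)) = of_mat k (ematrix d c)" for c d :: "'n list"
    by (auto simp: of_mat_adj of_mat_eq_iff ematrix_def)
  have mult_e: "of_mat k (ematrix c d) * of_mat k (ematrix d c') = of_mat k (ematrix c c')"
    if "d \<in> words k" for c d c' :: "'n list"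
  proof -
    have "mmult k (ematrix c d) (ematrix d c') v w = ematrix c c' v w" for v w
      using delta[OF that, of "v = c" "\<lambda>u. ematrix d c' u w"]
      by (simp add: mmult_def ematrix_def conj_commute)
    then show ?thesis by (simp add: of_mat_mult of_mat_eq_iff)
  qed
  have p: "adj e * e = p" "adj p = p" "p * p = p"
    unfolding e_def p_def using assms by (simp_all add: adj_e mult_e)
  have ee: "inner (e * x) (e * x) = inner (p * x) (p * x)"
    by (simp add: inner_mult_left_adj p flip: mult.assoc)
  have "inner (p * x) (x - p * x) = 0"
    by (simp add: inner_mult_left_adj p right_diff_distrib flip: mult.assoc)
  then have "inner x x = inner (p * x) (p * x) + inner (x - p * x) (x - p * x)"
    by (simp add: inner_diff_left inner_diff_right inner_commute)
  then have "inner (e * x) (e * x) \<le> inner x x"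
    using ee by simp
  then show ?thesis
    by (simp add: norm_eq_sqrt_inner e_def)
qed

lemma scaleR_eq_cscale: "r *\<^sub>R x = cscale (of_real r) (x :: 'n::finite tensor_alg)"
  by (rule scaleR_tensor_alg_def)

lemma bounded_linear_mult_left: "bounded_linear ((*) (a :: 'n::finite tensor_alg))"
proof -
  obtain k m where a: "a = of_mat k m" using ex_of_mat by blast
  let ?e = "\<lambda>v w x. cscale (m v w) (of_mat k (ematrix v w) * x)"
  have sum_of_mat: "(\<Sum>i\<in>I. of_mat k (f i)) = of_mat k (\<lambda>v w. \<Sum>i\<in>I. f i v w)"
    if "finite I" for I :: "'n list set" and f
    using that by induction (simp_all add: of_mat_add flip: of_mat_zero)
  have delta: "(\<Sum>v\<in>words k. \<Sum>w\<in>words k. m v w * ematrix v w p q) = m p q"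
    if "p \<in> words k" "q \<in> words k" for p q
  proof -
    have "(\<Sum>v\<in>words k. \<Sum>w\<in>words k. m v w * ematrix v w p q)
        = (\<Sum>v\<in>words k. \<Sum>w\<in>words k. if w = q then (if v = p then m v w else 0) else 0)"
      by (intro sum.cong) (auto simp: ematrix_def)
    then show ?thesis using that by simp
  qed
  have "a = (\<Sum>v\<in>words k. \<Sum>w\<in>words k. cscale (m v w) (of_mat k (ematrix v w)))"
    unfolding a of_mat_cscale by (simp add: sum_of_mat of_mat_eq_iff delta)
  then have "(*) a = (\<lambda>x. \<Sum>v\<in>words k. \<Sum>w\<in>words k. ?e v w x)"
    by (simp add: fun_eq_iff sum_distrib_right cscale_mult_left)
  moreover have "bounded_linear (\<lambda>x. \<Sum>v\<in>words k. \<Sum>w\<in>words k. ?e v w x)"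
  proof (intro bounded_linear_sum)
    fix v w :: "'n list" assume vw: "v \<in> words k" "w \<in> words k"
    have "bounded_linear ((*) (of_mat k (ematrix v w)))"
      by (rule bounded_linear_intro[where K = 1])
         (use norm_ematrix_mult[OF vw] in
           \<open>auto simp: distrib_left scaleR_eq_cscale cscale_mult_right\<close>)
    then show "bounded_linear (?e v w)"
      by (rule bounded_linear_compose[OF bounded_linear_cscale])
  qed
  ultimately show ?thesis by simp
qed


subsection \<open>Completion of a real inner product space\<close>

lemma Cauchy_norm_convergent:
  fixes X :: "nat \<Rightarrow> 'a::real_normed_vector"
  assumes "Cauchy X" shows "convergent (\<lambda>i. norm (X i))"
proof -
  have "Cauchy (\<lambda>i. norm (X i))"
    unfolding Cauchy_iff
  proof (intro allI impI)
    fix e :: real assume "e > 0"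
    then obtain M where "\<forall>m\<ge>M. \<forall>n\<ge>M. norm (X m - X n) < e"
      using assms unfolding Cauchy_iff by blast
    then show "\<exists>M. \<forall>m\<ge>M. \<forall>n\<ge>M. norm (norm (X m) - norm (X n)) < e"
      by (intro exI[of _ M]) (auto intro: le_less_trans[OF norm_triangle_ineq3])
  qed
  then show ?thesis by (rule Cauchy_convergent)
qed

lemma Cauchy_add':
  fixes X Y :: "nat \<Rightarrow> 'a::real_normed_vector"
  assumes "Cauchy X" "Cauchy Y" shows "Cauchy (\<lambda>i. X i + Y i)"
proof (rule metric_CauchyI)
  fix e :: real assume "e > 0"
  then have e: "e / 2 > 0" by simp
  obtain M where M: "\<forall>m\<ge>M. \<forall>n\<ge>M. dist (X m) (X n) < e / 2"
    using metric_CauchyD[OF assms(1) e] by blast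
  obtain N where N: "\<forall>m\<ge>N. \<forall>n\<ge>N. dist (Y m) (Y n) < e / 2"
    using metric_CauchyD[OF assms(2) e] by blast
  have "dist (X m + Y m) (X n + Y n) < e" if "m \<ge> max M N" "n \<ge> max M N" for m n
  proof -
    have "dist (X m) (X n) < e / 2" "dist (Y m) (Y n) < e / 2" using M N that by auto
    then show ?thesis using dist_triangle_add[of "X m" "Y m" "X n" "Y n"] by linarith
  qed
  then show "\<exists>M. \<forall>m\<ge>M. \<forall>n\<ge>M. dist (X m + Y m) (X n + Y n) < e" by blast
qed

lemma Cauchy_scaleR': "Cauchy X \<Longrightarrow> Cauchy (\<lambda>i. r *\<^sub>R (X i :: 'a::real_normed_vector))"
  by (rule bounded_linear.Cauchy[OF bounded_linear_scaleR_right])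

lemma Cauchy_minus': "Cauchy X \<Longrightarrow> Cauchy (\<lambda>i. - (X i :: 'a::real_normed_vector))"
  by (rule bounded_linear.Cauchy[OF bounded_linear_minus[OF bounded_linear_ident]])

lemma Cauchy_inner_convergent:
  fixes X Y :: "nat \<Rightarrow> 'a::real_inner"
  assumes "Cauchy X" "Cauchy Y" shows "convergent (\<lambda>i. inner (X i) (Y i))"
proof -
  obtain a b c where "(\<lambda>i. norm (X i + Y i)) \<longlonglongrightarrow> a" "(\<lambda>i. norm (X i)) \<longlonglongrightarrow> b"
      "(\<lambda>i. norm (Y i)) \<longlonglongrightarrow> c"
    using Cauchy_norm_convergent[OF Cauchy_add'[OF assms]] Cauchy_norm_convergent[OF assms(1)]
      Cauchy_norm_convergent[OF assms(2)] unfolding convergent_def by blast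
  then have "(\<lambda>i. ((norm (X i + Y i))\<^sup>2 - (norm (X i))\<^sup>2 - (norm (Y i))\<^sup>2) / 2)
      \<longlonglongrightarrow> (a\<^sup>2 - b\<^sup>2 - c\<^sup>2) / 2"
    by (intro tendsto_divide tendsto_diff tendsto_power tendsto_const) simp_all
  then show ?thesis
    unfolding convergent_def dot_norm by blast
qed

lemma inner_null_left:
  fixes X Y :: "nat \<Rightarrow> 'a::real_inner"
  assumes "X \<longlonglongrightarrow> 0" "Cauchy Y" shows "(\<lambda>i. inner (X i) (Y i)) \<longlonglongrightarrow> 0"
proof -
  obtain c where "(\<lambda>i. norm (Y i)) \<longlonglongrightarrow> c"
    using Cauchy_norm_convergent[OF assms(2)] convergent_def by blast
  then have "(\<lambda>i. norm (X i) * norm (Y i)) \<longlonglongrightarrow> 0 * c"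
    by (intro tendsto_mult tendsto_norm_zero assms(1))
  then have "(\<lambda>i. norm (X i) * norm (Y i)) \<longlonglongrightarrow> 0" by simp
  then show ?thesis
    by (rule Lim_null_comparison[rotated]) (simp add: Cauchy_Schwarz_ineq2)
qed

quotient_type (overloaded) 'a completion = "nat \<Rightarrow> 'a::real_inner" /
    partial: "\<lambda>X Y. Cauchy X \<and> Cauchy Y \<and> (\<lambda>i. X i - Y i) \<longlonglongrightarrow> 0"
proof (rule part_equivpI)
  show "\<exists>X :: nat \<Rightarrow> 'a. Cauchy X \<and> Cauchy X \<and> (\<lambda>i. X i - X i) \<longlonglongrightarrow> 0"
    by (intro exI[of _ "\<lambda>_. 0"]) (simp add: convergent_Cauchy convergent_const)
  show "symp (\<lambda>X Y :: nat \<Rightarrow> 'a. Cauchy X \<and> Cauchy Y \<and> (\<lambda>i. X i - Y i) \<longlonglongrightarrow> 0)"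
  proof (intro sympI conjI)
    fix X Y :: "nat \<Rightarrow> 'a"
    assume "Cauchy X \<and> Cauchy Y \<and> (\<lambda>i. X i - Y i) \<longlonglongrightarrow> 0"
    then show "Cauchy Y" "Cauchy X" "(\<lambda>i. Y i - X i) \<longlonglongrightarrow> 0"
      using tendsto_minus[of "\<lambda>i. X i - Y i" 0 sequentially] by auto
  qed
  show "transp (\<lambda>X Y :: nat \<Rightarrow> 'a. Cauchy X \<and> Cauchy Y \<and> (\<lambda>i. X i - Y i) \<longlonglongrightarrow> 0)"
  proof (intro transpI conjI)
    fix X Y Z :: "nat \<Rightarrow> 'a"
    assume "Cauchy X \<and> Cauchy Y \<and> (\<lambda>i. X i - Y i) \<longlonglongrightarrow> 0"
      "Cauchy Y \<and> Cauchy Z \<and> (\<lambda>i. Y i - Z i) \<longlonglongrightarrow> 0"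
    then show "Cauchy X" "Cauchy Z" "(\<lambda>i. X i - Z i) \<longlonglongrightarrow> 0"
      using tendsto_add[of "\<lambda>i. X i - Y i" 0 sequentially "\<lambda>i. Y i - Z i" 0] by auto
  qed
qed

instantiation completion :: (real_inner) real_inner
begin

lift_definition zero_completion :: "'a completion" is "\<lambda>_. 0"
  by (simp add: convergent_Cauchy convergent_const)

lift_definition plus_completion :: "'a completion \<Rightarrow> 'a completion \<Rightarrow> 'a completion"
  is "\<lambda>X Y i. X i + Y i"
proof -
  fix X X' Y Y' :: "nat \<Rightarrow> 'a"
  assume "Cauchy X \<and> Cauchy X' \<and> (\<lambda>i. X i - X' i) \<longlonglongrightarrow> 0"
    "Cauchy Y \<and> Cauchy Y' \<and> (\<lambda>i. Y i - Y' i) \<longlonglongrightarrow> 0"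
  then show "Cauchy (\<lambda>i. X i + Y i) \<and> Cauchy (\<lambda>i. X' i + Y' i) \<and>
      (\<lambda>i. X i + Y i - (X' i + Y' i)) \<longlonglongrightarrow> 0"
    using tendsto_add[of "\<lambda>i. X i - X' i" 0 sequentially "\<lambda>i. Y i - Y' i" 0]
    by (simp add: Cauchy_add' add_diff_add)
qed

lift_definition uminus_completion :: "'a completion \<Rightarrow> 'a completion" is "\<lambda>X i. - X i"
proof -
  fix X Y :: "nat \<Rightarrow> 'a"
  assume "Cauchy X \<and> Cauchy Y \<and> (\<lambda>i. X i - Y i) \<longlonglongrightarrow> 0"
  then show "Cauchy (\<lambda>i. - X i) \<and> Cauchy (\<lambda>i. - Y i) \<and> (\<lambda>i. - X i - - Y i) \<longlonglongrightarrow> 0"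
    using tendsto_minus[of "\<lambda>i. X i - Y i" 0 sequentially] by (simp add: Cauchy_minus')
qed

definition minus_completion :: "'a completion \<Rightarrow> 'a completion \<Rightarrow> 'a completion"
  where "minus_completion x y = x + - y"

lift_definition scaleR_completion :: "real \<Rightarrow> 'a completion \<Rightarrow> 'a completion"
  is "\<lambda>r X i. r *\<^sub>R X i"
proof -
  fix r and X Y :: "nat \<Rightarrow> 'a"
  assume "Cauchy X \<and> Cauchy Y \<and> (\<lambda>i. X i - Y i) \<longlonglongrightarrow> 0"
  then show "Cauchy (\<lambda>i. r *\<^sub>R X i) \<and> Cauchy (\<lambda>i. r *\<^sub>R Y i) \<and>
      (\<lambda>i. r *\<^sub>R X i - r *\<^sub>R Y i) \<longlonglongrightarrow> 0"
    using tendsto_scaleR[OF tendsto_const, of "\<lambda>i. X i - Y i" 0 sequentially r]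
    by (simp add: Cauchy_scaleR' scaleR_diff_right)
qed

lift_definition inner_completion :: "'a completion \<Rightarrow> 'a completion \<Rightarrow> real"
  is "\<lambda>X Y. lim (\<lambda>i. inner (X i) (Y i))"
proof -
  fix X X' Y Y' :: "nat \<Rightarrow> 'a"
  assume X: "Cauchy X \<and> Cauchy X' \<and> (\<lambda>i. X i - X' i) \<longlonglongrightarrow> 0"
    and Y: "Cauchy Y \<and> Cauchy Y' \<and> (\<lambda>i. Y i - Y' i) \<longlonglongrightarrow> 0"
  obtain c where c: "(\<lambda>i. inner (X' i) (Y' i)) \<longlonglongrightarrow> c"
    using Cauchy_inner_convergent X Y convergent_def by blast
  have "(\<lambda>i. inner (X i - X' i) (Y i) + inner (Y i - Y' i) (X' i) + inner (X' i) (Y' i))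
      \<longlonglongrightarrow> 0 + 0 + c"
    using X Y c by (intro tendsto_add inner_null_left) auto
  then have "(\<lambda>i. inner (X i) (Y i)) \<longlonglongrightarrow> c"
    by (simp add: inner_diff_left inner_diff_right inner_commute)
  then show "lim (\<lambda>i. inner (X i) (Y i)) = lim (\<lambda>i. inner (X' i) (Y' i))"
    using c limI by metis
qed

definition norm_completion :: "'a completion \<Rightarrow> real"
  where "norm_completion x = sqrt (inner x x)"

definition sgn_completion :: "'a completion \<Rightarrow> 'a completion"
  where "sgn_completion x = inverse (norm x) *\<^sub>R x"

definition dist_completion :: "'a completion \<Rightarrow> 'a completion \<Rightarrow> real"
  where "dist_completion x y = norm (x - y)"

definition uniformity_completion :: "('a completion \<times> 'a completion) filter"
  where "uniformity_completion = (INF e\<in>{0 <..}. principal {(x, y). dist x y < e})"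

definition open_completion :: "'a completion set \<Rightarrow> bool"
  where "open_completion U \<longleftrightarrow>
    (\<forall>x\<in>U. eventually (\<lambda>(x', y). x' = x \<longrightarrow> y \<in> U) uniformity)"

instance
proof
  fix x y z :: "'a completion" and a b :: real and U :: "'a completion set"
  show "dist x y = norm (x - y)" by (rule dist_completion_def)
  show "sgn x = inverse (norm x) *\<^sub>R x" by (rule sgn_completion_def)
  show "uniformity = (INF e\<in>{0 <..}. principal {(x :: 'a completion, y). dist x y < e})"
    by (rule uniformity_completion_def)
  show "open U \<longleftrightarrow> (\<forall>x\<in>U. eventually (\<lambda>(x', y). x' = x \<longrightarrow> y \<in> U) uniformity)"
    by (rule open_completion_def)
  show "norm x = sqrt (inner x x)" by (rule norm_completion_def)
  show "x + y + z = x + (y + z)" "x + y = y + x" "0 + x = x"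
    by (transfer, auto simp: algebra_simps Cauchy_add')+
  show "- x + x = 0"
    by transfer (simp add: convergent_Cauchy convergent_const)
  show "x - y = x + - y" by (rule minus_completion_def)
  show "a *\<^sub>R (x + y) = a *\<^sub>R x + a *\<^sub>R y" "(a + b) *\<^sub>R x = a *\<^sub>R x + b *\<^sub>R x"
       "a *\<^sub>R b *\<^sub>R x = (a * b) *\<^sub>R x" "1 *\<^sub>R x = x"
    by (transfer, auto simp: algebra_simps intro!: Cauchy_add' Cauchy_scaleR')+
  show "inner x y = inner y x"
    by transfer (simp add: inner_commute)
  show "inner (x + y) z = inner x z + inner y z"
  proof transfer
    fix X Y Z :: "nat \<Rightarrow> 'a"
    assume "Cauchy X \<and> Cauchy X \<and> (\<lambda>i. X i - X i) \<longlonglongrightarrow> 0"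
      "Cauchy Y \<and> Cauchy Y \<and> (\<lambda>i. Y i - Y i) \<longlonglongrightarrow> 0"
      "Cauchy Z \<and> Cauchy Z \<and> (\<lambda>i. Z i - Z i) \<longlonglongrightarrow> 0"
    then have "(\<lambda>i. inner (X i) (Z i)) \<longlonglongrightarrow> lim (\<lambda>i. inner (X i) (Z i))"
      "(\<lambda>i. inner (Y i) (Z i)) \<longlonglongrightarrow> lim (\<lambda>i. inner (Y i) (Z i))"
      using Cauchy_inner_convergent convergent_LIMSEQ_iff by blast+
    from tendsto_add[OF this]
    show "lim (\<lambda>i. inner (X i + Y i) (Z i))
        = lim (\<lambda>i. inner (X i) (Z i)) + lim (\<lambda>i. inner (Y i) (Z i))"
      by (intro limI) (simp add: inner_add_left)
  qed
  show "inner (a *\<^sub>R x) y = a * inner x y"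
  proof transfer
    fix a and X Y :: "nat \<Rightarrow> 'a"
    assume "Cauchy X \<and> Cauchy X \<and> (\<lambda>i. X i - X i) \<longlonglongrightarrow> 0"
      "Cauchy Y \<and> Cauchy Y \<and> (\<lambda>i. Y i - Y i) \<longlonglongrightarrow> 0"
    then have "(\<lambda>i. inner (X i) (Y i)) \<longlonglongrightarrow> lim (\<lambda>i. inner (X i) (Y i))"
      using Cauchy_inner_convergent convergent_LIMSEQ_iff by blast
    from tendsto_mult_left[OF this]
    show "lim (\<lambda>i. inner (a *\<^sub>R X i) (Y i)) = a * lim (\<lambda>i. inner (X i) (Y i))"
      by (intro limI) simp
  qed
  show "0 \<le> inner x x"
  proof transfer
    fix X :: "nat \<Rightarrow> 'a"
    assume "Cauchy X \<and> Cauchy X \<and> (\<lambda>i. X i - X i) \<longlonglongrightarrow> 0"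
    then have "(\<lambda>i. inner (X i) (X i)) \<longlonglongrightarrow> lim (\<lambda>i. inner (X i) (X i))"
      using Cauchy_inner_convergent convergent_LIMSEQ_iff by blast
    then show "0 \<le> lim (\<lambda>i. inner (X i) (X i))"
      by (rule LIMSEQ_le_const) simp
  qed
  show "inner x x = 0 \<longleftrightarrow> x = 0"
  proof transfer
    fix X :: "nat \<Rightarrow> 'a"
    assume X: "Cauchy X \<and> Cauchy X \<and> (\<lambda>i. X i - X i) \<longlonglongrightarrow> 0"
    then have lim: "(\<lambda>i. inner (X i) (X i)) \<longlonglongrightarrow> lim (\<lambda>i. inner (X i) (X i))"
      using Cauchy_inner_convergent convergent_LIMSEQ_iff by blast
    have "lim (\<lambda>i. inner (X i) (X i)) = 0 \<longleftrightarrow> X \<longlonglongrightarrow> 0"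
    proof
      assume "lim (\<lambda>i. inner (X i) (X i)) = 0"
      with lim have "(\<lambda>i. sqrt (inner (X i) (X i))) \<longlonglongrightarrow> sqrt 0"
        by (intro tendsto_real_sqrt) simp
      then show "X \<longlonglongrightarrow> 0"
        by (simp add: tendsto_norm_zero_iff flip: norm_eq_sqrt_inner)
    next
      assume "X \<longlonglongrightarrow> 0"
      then have "(\<lambda>i. inner (X i) (X i)) \<longlonglongrightarrow> inner 0 (0 :: 'a)"
        by (intro tendsto_inner)
      then show "lim (\<lambda>i. inner (X i) (X i)) = 0"
        by (intro limI) simp
    qed
    then show "(lim (\<lambda>i. inner (X i) (X i)) = 0)
        = (Cauchy X \<and> Cauchy (\<lambda>_. 0 :: 'a) \<and> (\<lambda>i. X i - 0) \<longlonglongrightarrow> 0)"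
      using X by (simp add: convergent_Cauchy convergent_const)
  qed
qed

end

lift_definition embed :: "'a::real_inner \<Rightarrow> 'a completion" is "\<lambda>x i. x"
  by (simp add: convergent_Cauchy convergent_const)

lemma inner_embed: "inner (embed x) (embed y) = inner x y"
  by transfer simp

lemma norm_embed: "norm (embed x) = norm x"
  by (simp add: norm_eq_sqrt_inner inner_embed)

lemma embed_add: "embed (x + y) = embed x + embed y"
  by transfer (simp add: convergent_Cauchy convergent_const)

lemma embed_scaleR: "embed (r *\<^sub>R x) = r *\<^sub>R embed x"
  by transfer (simp add: convergent_Cauchy convergent_const)

lemma bounded_linear_embed: "bounded_linear embed"
  by (rule bounded_linear_intro[where K = 1]) (auto simp: embed_add embed_scaleR norm_embed)

lemma embed_diff: "embed (x - y) = embed x - embed y"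
  using bounded_linear_embed by (rule linear_diff[OF bounded_linear.linear])

lemma norm_abs_completion:
  assumes "Cauchy X" shows "(\<lambda>i. norm (X i)) \<longlonglongrightarrow> norm (abs_completion X)"
proof -
  have "(\<lambda>i. inner (X i) (X i)) \<longlonglongrightarrow> lim (\<lambda>i. inner (X i) (X i))"
    using Cauchy_inner_convergent[OF assms assms] convergent_LIMSEQ_iff by blast
  also have "lim (\<lambda>i. inner (X i) (X i)) = inner (abs_completion X) (abs_completion X)"
    using assms by (simp add: inner_completion.abs_eq eq_onp_def)
  finally show ?thesis
    unfolding norm_eq_sqrt_inner by (rule tendsto_real_sqrt)
qed

lemma abs_completion_diff:
  assumes "Cauchy X" "Cauchy Y"
  shows "abs_completion X - abs_completion Y = abs_completion (\<lambda>i. X i - Y i)"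
  using assms
  by (simp add: minus_completion_def uminus_completion.abs_eq plus_completion.abs_eq Cauchy_minus')

lemma Cauchy_const': "Cauchy (\<lambda>i::nat. x :: 'a::real_normed_vector)"
  by (simp add: convergent_Cauchy convergent_const)

lemma embed_tendsto:
  assumes "Cauchy X" shows "(\<lambda>n. embed (X n)) \<longlonglongrightarrow> abs_completion X"
proof (rule LIMSEQ_I)
  fix e :: real assume "e > 0"
  then obtain M where M: "\<And>m n. m \<ge> M \<Longrightarrow> n \<ge> M \<Longrightarrow> norm (X m - X n) < e / 2"
    using assms unfolding Cauchy_iff by (meson half_gt_zero)
  have "norm (embed (X n) - abs_completion X) < e" if "n \<ge> M" for n
  proof -
    have "Cauchy (\<lambda>i. X n - X i)"
      using Cauchy_add'[OF Cauchy_const' Cauchy_minus'[OF assms]] by simp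
    then have "(\<lambda>i. norm (X n - X i)) \<longlonglongrightarrow> norm (embed (X n) - abs_completion X)"
      using norm_abs_completion
      by (simp add: embed.abs_eq abs_completion_diff Cauchy_const' assms)
    then have "norm (embed (X n) - abs_completion X) \<le> e / 2"
      by (rule LIMSEQ_le_const2) (use M that in \<open>auto intro!: exI[of _ M] less_imp_le\<close>)
    then show ?thesis using \<open>e > 0\<close> by simp
  qed
  then show "\<exists>M. \<forall>n\<ge>M. norm (embed (X n) - abs_completion X) < e" by blast
qed

lemma embed_dense: "\<exists>X. (\<lambda>n. embed (X n)) \<longlonglongrightarrow> (x :: 'a::real_inner completion)"
proof (induct x rule: completion.abs_induct)
  case (1 X)
  then show ?case using embed_tendsto by blast
qed

instance completion :: (real_inner) complete_space
proof
  fix X :: "nat \<Rightarrow> 'a completion" assume X: "Cauchy X"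
  have "\<exists>y. norm (embed y - X n) < inverse (real (Suc n))" for n
    using embed_dense[of "X n"] unfolding LIMSEQ_iff
    by (metis inverse_positive_iff_positive of_nat_0_less_iff order_refl zero_less_Suc)
  then obtain Y where Y: "\<And>n. norm (embed (Y n) - X n) < inverse (real (Suc n))" by metis
  have null: "(\<lambda>n. embed (Y n) - X n) \<longlonglongrightarrow> 0"
    by (rule Lim_null_comparison[OF always_eventually LIMSEQ_inverse_real_of_nat])
       (use Y in \<open>auto intro: less_imp_le\<close>)
  then have "Cauchy (\<lambda>n. (embed (Y n) - X n) + X n)"
    by (intro Cauchy_add' X convergent_Cauchy convergentI)
  then have "Cauchy Y"
    by (simp add: Cauchy_iff norm_embed flip: embed_diff)
  then have "(\<lambda>n. embed (Y n) - (embed (Y n) - X n)) \<longlonglongrightarrow> abs_completion Y - 0"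
    by (intro tendsto_diff embed_tendsto null)
  then show "convergent X"
    by (auto intro: convergentI)
qed

text \<open>The extension of a bounded operator by continuity.\<close>

lift_definition extend_fun ::
    "('a::real_inner \<Rightarrow>\<^sub>L 'b::real_inner) \<Rightarrow> 'a completion \<Rightarrow> 'b completion"
  is "\<lambda>f X i. blinfun_apply f (X i)"
proof -
  fix f :: "'a \<Rightarrow>\<^sub>L 'b" and X Y :: "nat \<Rightarrow> 'a"
  assume "Cauchy X \<and> Cauchy Y \<and> (\<lambda>i. X i - Y i) \<longlonglongrightarrow> 0"
  then show "Cauchy (\<lambda>i. f (X i)) \<and> Cauchy (\<lambda>i. f (Y i)) \<and> (\<lambda>i. f (X i) - f (Y i)) \<longlonglongrightarrow> 0"
    using bounded_linear.Cauchy[OF blinfun.bounded_linear_right[of f]]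
      bounded_linear.tendsto[OF blinfun.bounded_linear_right[of f], of "\<lambda>i. X i - Y i" 0]
    by (simp add: blinfun.diff_right)
qed

lemma extend_fun_bound: "norm (extend_fun f \<xi>) \<le> norm f * norm \<xi>"
proof (induct \<xi> rule: completion.abs_induct)
  case (1 X)
  have X: "Cauchy X" using 1 by blast
  then have fX: "Cauchy (\<lambda>i. f (X i))"
    by (rule bounded_linear.Cauchy[OF blinfun.bounded_linear_right])
  have "(\<lambda>i. norm f * norm (X i)) \<longlonglongrightarrow> norm f * norm (abs_completion X)"
    by (intro tendsto_mult_left norm_abs_completion X)
  then show ?case
    using LIMSEQ_le[OF norm_abs_completion[OF fX]] norm_blinfun[of f] X
    by (auto simp: extend_fun.abs_eq)
qed

lemma bounded_linear_extend_fun: "bounded_linear (extend_fun f)"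
proof (rule bounded_linear_intro)
  show "norm (extend_fun f \<xi>) \<le> norm \<xi> * norm f" for \<xi>
    using extend_fun_bound[of f \<xi>] by (simp add: mult.commute)
  show "extend_fun f (\<xi> + \<eta>) = extend_fun f \<xi> + extend_fun f \<eta>" for \<xi> \<eta>
    by transfer (auto simp: blinfun.add_right
        intro!: Cauchy_add' bounded_linear.Cauchy[OF blinfun.bounded_linear_right])
  show "extend_fun f (r *\<^sub>R \<xi>) = r *\<^sub>R extend_fun f \<xi>" for r \<xi>
    by transfer (auto simp: blinfun.scaleR_right
        intro!: Cauchy_scaleR' bounded_linear.Cauchy[OF blinfun.bounded_linear_right])
qed

lift_definition extend ::
    "('a::real_inner \<Rightarrow>\<^sub>L 'b::real_inner) \<Rightarrow> 'a completion \<Rightarrow>\<^sub>L 'b completion"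
  is extend_fun by (rule bounded_linear_extend_fun)

lemma extend_embed: "extend f (embed x) = embed (f x)"
  unfolding extend.rep_eq by transfer (simp add: Cauchy_const')


subsection \<open>The GNS space\<close>

type_synonym 'n gns = "'n tensor_alg completion"

definition cscale_op :: "complex \<Rightarrow> 'n::finite tensor_alg \<Rightarrow>\<^sub>L 'n tensor_alg"
  where "cscale_op c = Blinfun (cscale c)"

definition mult_op :: "'n::finite tensor_alg \<Rightarrow> 'n tensor_alg \<Rightarrow>\<^sub>L 'n tensor_alg"
  where "mult_op a = Blinfun ((*) a)"

lemma cscale_op_apply [simp]: "cscale_op c x = cscale c x"
  by (simp add: cscale_op_def bounded_linear_Blinfun_apply bounded_linear_cscale)

lemma mult_op_apply [simp]: "mult_op a x = a * x"
  by (simp add: mult_op_def bounded_linear_Blinfun_apply bounded_linear_mult_left)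

definition scaleC :: "complex \<Rightarrow> 'n::finite gns \<Rightarrow> 'n gns"
  where "scaleC c \<xi> = extend (cscale_op c) \<xi>"

text \<open>
  The complex inner product, linear in the first argument, recovered from its real part
  \<open>inner\<close>.
\<close>

definition cinner :: "'n::finite gns \<Rightarrow> 'n gns \<Rightarrow> complex"
  where "cinner \<xi> \<eta> = Complex (inner \<xi> \<eta>) (inner \<xi> (scaleC \<i> \<eta>))"

lemma cinner_embed: "cinner (embed x) (embed y) = trc (adj y * x)"
proof -
  have "inner x (cscale \<i> y) = Im (sesq x y)"
    by (simp add: inner_tensor_alg_def sesq_cscale_right)
  then show ?thesis
    by (simp add: cinner_def scaleC_def extend_embed inner_embed complex_eq_iff
        inner_tensor_alg_def sesq_def)
qed

definition gns_rep :: "'n::finite tensor_alg \<Rightarrow> 'n gns \<Rightarrow>\<^sub>L 'n gns"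
  where "gns_rep a = extend (mult_op a)"

definition gns_vec :: "'n::finite gns"
  where "gns_vec = embed 1"

lemma gns_rep_embed: "gns_rep a (embed x) = embed (a * x)"
  by (simp add: gns_rep_def extend_embed)

lemma cinner_gns_rep: "cinner (gns_rep a gns_vec) gns_vec = trc a"
proof -
  have "adj 1 = (1 :: 'a tensor_alg)" by transfer (intro ext, auto)
  then show ?thesis by (simp add: gns_vec_def gns_rep_embed cinner_embed)
qed

text \<open>
  The bounded complex-linear operators.  Real-linear operators commuting with \<open>\<i>\<close> are
  complex-linear, and their operator norm is the norm of \<open>\<Rightarrow>\<^sub>L\<close>.
\<close>

definition bounded_operators :: "('n::finite gns \<Rightarrow>\<^sub>L 'n gns) set"
  where "bounded_operators = {T. \<forall>\<xi>. blinfun_apply T (scaleC \<i> \<xi>) = scaleC \<i> (blinfun_apply T \<xi>)}"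

definition weak_operator_topology :: "('n::finite gns \<Rightarrow>\<^sub>L 'n gns) topology"
  where "weak_operator_topology =
    pullback_topology bounded_operators (\<lambda>T (\<xi>, \<eta>). cinner (blinfun_apply T \<xi>) \<eta>) euclidean"

lemma topspace_weak_operator_topology: "topspace weak_operator_topology = bounded_operators"
  by (simp add: weak_operator_topology_def topspace_pullback_topology)

lemma gns_rep_bounded_operators: "gns_rep a \<in> bounded_operators"
  unfolding bounded_operators_def
proof (intro CollectI allI)
  fix \<xi> :: "'a gns"
  obtain X where X: "(\<lambda>n. embed (X n)) \<longlonglongrightarrow> \<xi>" using embed_dense by blast
  have eq: "gns_rep a (scaleC \<i> (embed x)) = scaleC \<i> (gns_rep a (embed x))" for x
    by (simp add: scaleC_def extend_embed gns_rep_embed cscale_mult_right)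
  have 1: "(\<lambda>n. gns_rep a (scaleC \<i> (embed (X n)))) \<longlonglongrightarrow> gns_rep a (scaleC \<i> \<xi>)"
    unfolding scaleC_def by (intro tendsto_intros X)
  have 2: "(\<lambda>n. gns_rep a (scaleC \<i> (embed (X n)))) \<longlonglongrightarrow> scaleC \<i> (gns_rep a \<xi>)"
    unfolding eq unfolding scaleC_def by (intro tendsto_intros X)
  show "gns_rep a (scaleC \<i> \<xi>) = scaleC \<i> (gns_rep a \<xi>)"
    by (rule LIMSEQ_unique[OF 1 2])
qed

definition op_adj :: "('n::finite gns \<Rightarrow>\<^sub>L 'n gns) \<Rightarrow> 'n gns \<Rightarrow>\<^sub>L 'n gns"
  where "op_adj T = (THE S. \<forall>\<xi> \<eta>. cinner (T \<xi>) \<eta> = cinner \<xi> (blinfun_apply S \<eta>))"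

lemma riesz_representation:
  fixes f :: "'a::{real_inner, complete_space} \<Rightarrow> real"
  assumes "bounded_linear f" shows "\<exists>z. \<forall>x. f x = inner x z"
proof (cases "\<forall>x. f x = 0")
  case True
  then show ?thesis by (intro exI[of _ 0]) simp
next
  case False
  interpret f: bounded_linear f by fact
  obtain x0 where x0: "f x0 \<noteq> 0" using False by blast
  define S where "S = {x. f x = 1}"
  define d where "d = Inf (norm ` S)"
  have "x0 /\<^sub>R f x0 \<in> S" using x0 by (simp add: S_def f.scaleR)
  then have ne: "norm ` S \<noteq> {}" by blast
  have bdd: "bdd_below (norm ` S)" by (rule bdd_belowI[of _ 0]) auto
  have d_le: "d \<le> norm x" if "x \<in> S" for x
    unfolding d_def using that bdd by (simp add: cInf_lower)
  have d0: "d \<ge> 0" unfolding d_def using ne by (auto intro: cInf_greatest)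
  have "\<exists>x\<in>S. norm x < d + inverse (real (Suc n))" for n
    using cInf_lessD[OF ne, of "d + inverse (real (Suc n))"] unfolding d_def by auto
  then obtain X where X: "\<And>n. X n \<in> S" "\<And>n. norm (X n) < d + inverse (real (Suc n))" by metis
  have lim: "(\<lambda>n. norm (X n)) \<longlonglongrightarrow> d"
  proof (rule tendsto_sandwich[of "\<lambda>_. d" _ _ "\<lambda>n. d + inverse (real (Suc n))"])
    show "(\<lambda>n. d + inverse (real (Suc n))) \<longlonglongrightarrow> d"
      by (rule LIMSEQ_inverse_real_of_nat_add)
  qed (use X d_le in \<open>auto intro!: always_eventually less_imp_le\<close>)
  have par: "(norm (X m - X n))\<^sup>2 \<le> 2 * (norm (X m))\<^sup>2 + 2 * (norm (X n))\<^sup>2 - 4 * d\<^sup>2" for m n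
  proof -
    have "(1 / 2) *\<^sub>R (X m + X n) \<in> S"
      using X by (simp add: S_def f.scaleR f.add)
    then have "2 * d \<le> norm (X m + X n)" using d_le by fastforce
    then have "(2 * d)\<^sup>2 \<le> (norm (X m + X n))\<^sup>2" using d0 by (intro power_mono) auto
    moreover have "(norm (X m - X n))\<^sup>2 + (norm (X m + X n))\<^sup>2
        = 2 * (norm (X m))\<^sup>2 + 2 * (norm (X n))\<^sup>2"
      by (simp add: power2_norm_eq_inner inner_add_left inner_add_right inner_diff_left
          inner_diff_right)
    ultimately show ?thesis by (simp add: power_mult_distrib)
  qed
  have "Cauchy X"
    unfolding Cauchy_iff
  proof (intro allI impI)
    fix e :: real assume e: "e > 0"
    have "(\<lambda>n. (norm (X n))\<^sup>2) \<longlonglongrightarrow> d\<^sup>2" by (intro tendsto_power lim)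
    moreover have "d\<^sup>2 < d\<^sup>2 + e\<^sup>2 / 4" using e by simp
    ultimately have "eventually (\<lambda>n. (norm (X n))\<^sup>2 < d\<^sup>2 + e\<^sup>2 / 4) sequentially"
      by (rule order_tendstoD(2))
    then obtain M where M: "\<And>n. n \<ge> M \<Longrightarrow> (norm (X n))\<^sup>2 < d\<^sup>2 + e\<^sup>2 / 4"
      unfolding eventually_sequentially by blast
    have "norm (X m - X n) < e" if "m \<ge> M" "n \<ge> M" for m n
    proof -
      have "(norm (X m - X n))\<^sup>2 < e\<^sup>2"
        using par[of m n] M[OF that(1)] M[OF that(2)] by linarith
      then show ?thesis using e by (simp add: power2_less_imp_less)
    qed
    then show "\<exists>M. \<forall>m\<ge>M. \<forall>n\<ge>M. norm (X m - X n) < e" by blast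
  qed
  then obtain z where z: "X \<longlonglongrightarrow> z" using Cauchy_convergent convergent_def by blast
  have "(\<lambda>n. f (X n)) \<longlonglongrightarrow> f z" by (rule f.tendsto[OF z])
  then have fz: "f z = 1" using X by (simp add: S_def LIMSEQ_const_iff)
  have nz: "norm z = d" using tendsto_norm[OF z] lim LIMSEQ_unique by blast
  have orth: "inner y z = 0" if y: "f y = 0" for y
  proof (rule ccontr)
    assume n: "inner y z \<noteq> 0"
    then have yy: "inner y y > 0" by auto
    define t where "t = - inner y z / inner y y"
    have "z + t *\<^sub>R y \<in> S" using fz y by (simp add: S_def f.add f.scaleR)
    then have "(norm z)\<^sup>2 \<le> (norm (z + t *\<^sub>R y))\<^sup>2"
      using d_le nz by (intro power_mono) auto
    also have "\<dots> = inner z z + 2 * (t * inner y z) + t * (t * inner y y)"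
      unfolding power2_norm_eq_inner
      by (simp add: inner_add_left inner_add_right inner_commute[of z y] ring_distribs)
    also have "t * inner y y = - inner y z"
      using yy by (simp add: t_def)
    finally have "0 \<le> t * inner y z"
      by (simp add: power2_norm_eq_inner)
    moreover have "t * inner y z = - ((inner y z * inner y z) / inner y y)"
      by (simp add: t_def)
    moreover have "inner y z * inner y z / inner y y > 0"
      using yy n by (intro divide_pos_pos) (auto simp: zero_less_mult_iff)
    ultimately show False by linarith
  qed
  have z0: "inner z z \<noteq> 0" using fz by auto
  have "f x = inner x (z /\<^sub>R inner z z)" for x
  proof -
    have "inner x z = f x * inner z z"
      using orth[of "x - f x *\<^sub>R z"] fz by (simp add: f.diff f.scaleR inner_diff_left)
    then show ?thesis using z0 by (simp add: field_simps)
  qed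
  then show ?thesis by blast
qed

lemma inner_scaleC_i: "inner (scaleC \<i> \<xi>) \<eta> = - inner \<xi> (scaleC \<i> \<eta>)"
proof -
  obtain X where X: "(\<lambda>n. embed (X n)) \<longlonglongrightarrow> \<xi>" using embed_dense by blast
  obtain Y where Y: "(\<lambda>n. embed (Y n)) \<longlonglongrightarrow> \<eta>" using embed_dense by blast
  have cont: "(\<lambda>n. scaleC \<i> (Z n)) \<longlonglongrightarrow> scaleC \<i> \<zeta>" if "Z \<longlonglongrightarrow> \<zeta>"
    for Z :: "nat \<Rightarrow> 'a gns" and \<zeta>
    unfolding scaleC_def using that by (intro tendsto_intros)
  have "(\<lambda>n. inner (scaleC \<i> (embed (X n))) (embed (Y n))) \<longlonglongrightarrow> inner (scaleC \<i> \<xi>) \<eta>"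
    by (intro tendsto_inner cont X Y)
  moreover have "inner (scaleC \<i> (embed x)) (embed y) = - inner (embed x) (scaleC \<i> (embed y))"
    for x y :: "'a tensor_alg"
    by (simp add: scaleC_def extend_embed inner_embed inner_tensor_alg_def sesq_cscale_left
        sesq_cscale_right)
  ultimately have 1: "(\<lambda>n. - inner (embed (X n)) (scaleC \<i> (embed (Y n))))
      \<longlonglongrightarrow> inner (scaleC \<i> \<xi>) \<eta>"
    by simp
  have 2: "(\<lambda>n. - inner (embed (X n)) (scaleC \<i> (embed (Y n))))
      \<longlonglongrightarrow> - inner \<xi> (scaleC \<i> \<eta>)"
    by (intro tendsto_minus tendsto_inner cont X Y)
  show ?thesis by (rule LIMSEQ_unique[OF 1 2])
qed

lemma cinner_commute: "cinner \<eta> \<xi> = cnj (cinner \<xi> \<eta>)"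
  using inner_scaleC_i[of \<xi> \<eta>]
  by (simp add: cinner_def complex_eq_iff inner_commute[of \<eta>  \<xi>]
      inner_commute[of \<eta> "scaleC \<i> \<xi>"])

lemma cinner_op_adj:
  assumes T: "T \<in> bounded_operators"
  shows "cinner (T \<xi>) \<eta> = cinner \<xi> (op_adj T \<eta>)"
proof -
  have "\<exists>\<zeta>. \<forall>\<xi>. inner (T \<xi>) \<eta> = inner \<xi> \<zeta>" for \<eta>
    by (rule riesz_representation)
       (rule bounded_linear_compose[OF bounded_linear_inner_left blinfun.bounded_linear_right])
  then obtain S where S: "\<And>\<xi> \<eta>. inner (T \<xi>) \<eta> = inner \<xi> (S \<eta>)" by metis
  have S_eq: "\<zeta> = S \<eta>" if "\<And>\<xi>. inner (T \<xi>) \<eta> = inner \<xi> \<zeta>" for \<zeta> \<eta>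
  proof -
    have "inner \<xi> (\<zeta> - S \<eta>) = 0" for \<xi>
      using that[of \<xi>] S[of \<xi> \<eta>] by (simp add: inner_diff_right)
    from this[of "\<zeta> - S \<eta>"] show ?thesis by simp
  qed
  have "bounded_linear S"
  proof (rule bounded_linear_intro[where K = "norm T"])
    show "S (\<eta> + \<eta>') = S \<eta> + S \<eta>'" for \<eta> \<eta>'
      by (rule S_eq[symmetric]) (simp add: inner_add_right S)
    show "S (r *\<^sub>R \<eta>) = r *\<^sub>R S \<eta>" for r \<eta>
      by (rule S_eq[symmetric]) (simp add: S)
    show "norm (S \<eta>) \<le> norm \<eta> * norm T" for \<eta>
    proof (cases "S \<eta> = 0")
      case False
      have "norm (S \<eta>) * norm (S \<eta>) = inner (T (S \<eta>)) \<eta>"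
        by (simp only: S power2_norm_eq_inner[symmetric] power2_eq_square)
      also have "\<dots> \<le> norm (T (S \<eta>)) * norm \<eta>" by (rule norm_cauchy_schwarz)
      also have "\<dots> \<le> norm T * norm (S \<eta>) * norm \<eta>"
        by (intro mult_right_mono norm_blinfun) auto
      finally show ?thesis using False by (simp add: mult_ac)
    qed simp
  qed
  then have SB: "Blinfun S \<eta> = S \<eta>" for \<eta> by (simp add: bounded_linear_Blinfun_apply)
  have Si: "S (scaleC \<i> \<eta>) = scaleC \<i> (S \<eta>)" for \<eta>
  proof (rule S_eq[symmetric])
    fix \<xi>
    have "T (scaleC \<i> \<xi>) = scaleC \<i> (T \<xi>)" using T by (simp add: bounded_operators_def)
    then show "inner (T \<xi>) (scaleC \<i> \<eta>) = inner \<xi> (scaleC \<i> (S \<eta>))"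
      using S[of "scaleC \<i> \<xi>" \<eta>] by (simp add: inner_scaleC_i)
  qed
  have "op_adj T = Blinfun S"
    unfolding op_adj_def
  proof (rule the_equality)
    show "\<forall>\<xi> \<eta>. cinner (T \<xi>) \<eta> = cinner \<xi> (Blinfun S \<eta>)"
      by (simp add: cinner_def SB S Si)
    fix R assume R: "\<forall>\<xi> \<eta>. cinner (T \<xi>) \<eta> = cinner \<xi> (blinfun_apply R \<eta>)"
    have "R \<eta> = Blinfun S \<eta>" for \<eta>
      unfolding SB by (rule S_eq) (use R in \<open>simp add: cinner_def\<close>)
    then show "R = Blinfun S" by (rule blinfun_eqI)
  qed
  then show ?thesis by (simp add: cinner_def SB S Si)
qed

definition hyperfinite_factor :: "('n::finite gns \<Rightarrow>\<^sub>L 'n gns) set"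
  where "hyperfinite_factor = weak_operator_topology closure_of (range gns_rep)"

text \<open>The trace of \<open>hyperfinite_factor\<close>; by \<open>cinner_gns_rep\<close> it extends \<open>trc\<close>.\<close>

definition op_trace :: "('n::finite gns \<Rightarrow>\<^sub>L 'n gns) \<Rightarrow> complex"
  where "op_trace T = cinner (T gns_vec) gns_vec"

definition trace_norm :: "('n::finite gns \<Rightarrow>\<^sub>L 'n gns) \<Rightarrow> real"
  where "trace_norm T = sqrt (Re (op_trace (op_adj T o\<^sub>L T)))"


lemma trace_norm_eq:
  assumes "T \<in> bounded_operators" shows "trace_norm T = norm (T gns_vec)"
proof -
  have "op_trace (op_adj T o\<^sub>L T) = cnj (cinner (T gns_vec) (T gns_vec))"
    using cinner_op_adj[OF assms, of gns_vec "T gns_vec"]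
    unfolding op_trace_def
    by (simp add: cinner_commute[of "op_adj T (T gns_vec)" gns_vec])
  then show ?thesis
    by (simp add: trace_norm_def cinner_def norm_eq_sqrt_inner)
qed


section \<open>Hadamard unitaries and spin model subfactors\<close>

definition matrix_adj :: "complex^'n^'n \<Rightarrow> complex^'n^'n"
  where "matrix_adj u = (\<chi> i j. cnj (u $ j $ i))"

definition hadamard_unitary :: "complex^'n::finite^'n \<Rightarrow> bool"
  where "hadamard_unitary u \<longleftrightarrow>
    u ** matrix_adj u = mat 1 \<and> matrix_adj u ** u = mat 1 \<and>
    (\<forall>i j. cmod (u $ i $ j) = 1 / sqrt (real CARD('n)))"

definition matrix_unit :: "'n::finite \<Rightarrow> 'n \<Rightarrow> complex^'n^'n"
  where "matrix_unit i j = (\<chi> a b. if a = i \<and> b = j then 1 else 0)"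

text \<open>The elementary tensor \<open>x\<^sub>1 \<otimes> \<dots> \<otimes> x\<^sub>k\<close> for a list \<open>[x\<^sub>1, \<dots>, x\<^sub>k]\<close>.\<close>

definition tensor :: "(complex^'n::finite^'n) list \<Rightarrow> 'n tensor_alg"
  where "tensor xs = of_mat (length xs) (\<lambda>v w. \<Prod>i<length xs. (xs ! i) $ (v ! i) $ (w ! i))"

text \<open>The map \<open>x \<mapsto> I \<otimes> x\<close>.\<close>

lift_definition shift :: "'n::finite tensor_alg \<Rightarrow> 'n tensor_alg"
  is "\<lambda>x s t. if s 0 = t 0 then x (\<lambda>i. s (Suc i)) (\<lambda>i. t (Suc i)) else 0"
proof -
  fix x :: "(nat \<Rightarrow> 'n) \<Rightarrow> (nat \<Rightarrow> 'n) \<Rightarrow> complex"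
  assume "x \<in> (\<Union>k. range (kern k))"
  then obtain k m where x: "x = kern k m" by blast
  have "(\<lambda>s t. if s 0 = t 0 then x (\<lambda>i. s (Suc i)) (\<lambda>i. t (Suc i)) else 0)
      = kern (Suc k) (\<lambda>v w. if hd v = hd w then m (tl v) (tl w) else 0)"
  proof (intro ext)
    fix s t :: "nat \<Rightarrow> 'n"
    have 1: "(\<forall>i\<ge>Suc k. s i = t i) \<longleftrightarrow> (\<forall>i\<ge>k. s (Suc i) = t (Suc i))"
      by (metis Suc_le_D Suc_le_mono)
    have 2: "map s [0..<Suc k] = s 0 # map (\<lambda>i. s (Suc i)) [0..<k]" for s :: "nat \<Rightarrow> 'n"
      by (simp add: upt_conv_Cons map_Suc_upt[symmetric] del: upt_Suc)
    show "(if s 0 = t 0 then x (\<lambda>i. s (Suc i)) (\<lambda>i. t (Suc i)) else 0)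
        = kern (Suc k) (\<lambda>v w. if hd v = hd w then m (tl v) (tl w) else 0) s t"
      unfolding x kern_def 1 2 by auto
  qed
  then show "(\<lambda>s t. if s 0 = t 0 then x (\<lambda>i. s (Suc i)) (\<lambda>i. t (Suc i)) else 0)
      \<in> (\<Union>k. range (kern k))"
    by blast
qed

definition spin_diag :: "complex^'n::finite^'n \<Rightarrow> 'n tensor_alg"
  where "spin_diag u = cscale (of_real (sqrt (real CARD('n))))
    (\<Sum>i\<in>UNIV. \<Sum>j\<in>UNIV. cscale (cnj (u $ i $ j)) (tensor [matrix_unit j j, matrix_unit i i]))"

definition spin_u1 :: "complex^'n::finite^'n \<Rightarrow> 'n tensor_alg"
  where "spin_u1 u = tensor [u, mat 1] * spin_diag u"

text \<open>\<open>spin_unitary u k\<close> is \<open>u\<^sub>2\<^sub>k\<^sub>-\<^sub>1\<close>; the \<open>i\<close>-th factor is \<open>I\<^sup>\<otimes>\<^sup>i \<otimes> u\<^sub>1 \<otimes> I\<^sup>\<otimes>\<^sup>(\<^sup>k\<^sup>-\<^sup>1\<^sup>-\<^sup>i\<^sup>)\<close>.\<close>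

definition spin_unitary :: "complex^'n::finite^'n \<Rightarrow> nat \<Rightarrow> 'n tensor_alg"
  where "spin_unitary u k = prod_list (map (\<lambda>i. (shift ^^ i) (spin_u1 u)) [0..<k])"

definition spin_subfactor :: "complex^'n::finite^'n \<Rightarrow> ('n gns \<Rightarrow>\<^sub>L 'n gns) set"
  where "spin_subfactor u = weak_operator_topology closure_of
    (\<Union>k\<in>{1..}. gns_rep ` {spin_unitary u k * x * adj (spin_unitary u k) | x. x \<in> level k})"

lemma spin_subfactor_subset: "spin_subfactor u \<subseteq> hyperfinite_factor"
  unfolding spin_subfactor_def hyperfinite_factor_def by (rule closure_of_mono) blast


section \<open>The Mashood--Taylor distance\<close>

definition op_ball :: "('n::finite gns \<Rightarrow>\<^sub>L 'n gns) set \<Rightarrow> ('n gns \<Rightarrow>\<^sub>L 'n gns) set"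
  where "op_ball P = {x \<in> P. norm x \<le> 1}"

text \<open>
  The suprema and infima are those of nonempty bounded sets of reals: \<open>0\<close> lies in the unit ball
  of every subalgebra, and the trace norm is dominated by the operator norm.
\<close>

definition mt_distance ::
    "('n::finite gns \<Rightarrow>\<^sub>L 'n gns) set \<Rightarrow> ('n gns \<Rightarrow>\<^sub>L 'n gns) set \<Rightarrow> real"
  where "mt_distance P Q = max
    (SUP x\<in>op_ball P. INF y\<in>op_ball Q. trace_norm (x - y))
    (SUP y\<in>op_ball Q. INF x\<in>op_ball P. trace_norm (x - y))"

end

theory Submission
  imports Defs
begin

text \<open>
  Up to factors that do not change the subfactor, a Hadamard unitary of size two is
  \<open>diag(1, e\<^sup>i\<^sup>\<theta>) F\<close> with \<open>F\<close> the Fourier matrix (\<open>phase_hadamard \<theta>\<close>).  Let \<open>P\<^sub>\<theta>\<close>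
  (\<open>twisted_flip \<theta>\<close>) be the self-adjoint unitary with diagonal zero and off-diagonal entries
  \<open>e\<^sup>-\<^sup>i\<^sup>\<theta>, e\<^sup>i\<^sup>\<theta>\<close>, let \<open>X = P\<^sub>0\<close>, and let \<open>N\<^sub>k = P\<^sub>\<theta> \<otimes> X \<otimes> \<dots> \<otimes> X\<close> with \<open>k\<close> factors \<open>X\<close>
  (\<open>flip_chain \<theta> k\<close>).  The key identity is
  \<open>N\<^sub>k u\<^sub>2\<^sub>k\<^sub>-\<^sub>1 = u\<^sub>2\<^sub>k\<^sub>-\<^sub>1 (I\<^sup>\<otimes>\<^sup>k \<otimes> P\<^sub>\<theta>)\<close> (\<open>flip_chain_intertwines\<close>): conjugation by \<open>u\<^sub>2\<^sub>k\<^sub>-\<^sub>1\<close>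
  turns commuting with \<open>P\<^sub>\<theta>\<close> at the last site into commuting with \<open>N\<^sub>k\<close>.  Therefore the
  increasing union whose weak closure is the subfactor \<open>R\<^sub>\<theta>\<close> of this unitary consists exactly of the elements fixed by the symmetry
  \<open>\<sigma>\<^sub>\<theta> = lim Ad N\<^sub>k\<close> (\<open>spin_algebra_iff\<close>).

  Two of these symmetries differ by an inner automorphism, \<open>\<sigma>\<^sub>\<beta> = Ad w \<circ> \<sigma>\<^sub>\<alpha>\<close> with
  \<open>w = P\<^sub>\<beta> P\<^sub>\<alpha> = diag(e\<^sup>-\<^sup>i\<^sup>\<delta>, e\<^sup>i\<^sup>\<delta>)\<close> and \<open>\<delta> = \<beta> - \<alpha>\<close>.  So the conditional expectation
  \<open>x \<mapsto> (x + \<sigma>\<^sub>\<beta> x) / 2\<close> onto \<open>R\<^sub>\<beta>\<close> reads \<open>x \<mapsto> (x + w x w\<^sup>*) / 2\<close> on \<open>R\<^sub>\<alpha>\<close>.  That formula makes sense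
  for every bounded operator and is weakly continuous, so it maps the unit ball of \<open>R\<^sub>\<alpha>\<close> into that
  of \<open>R\<^sub>\<beta>\<close> although \<open>\<sigma>\<^sub>\<beta>\<close> is only known on the dense subalgebra.  Since \<open>w\<close> is \<open>cos \<delta>\<close> plus
  \<open>sin \<delta>\<close> times a unitary, averaging moves \<open>x\<close> by at most \<open>\<bar>sin \<delta>\<bar>\<close> in trace norm
  (\<open>spin_factor_near\<close>).  This bound is attained at \<open>x = P\<^sub>\<alpha>\<close>: the unitary \<open>P\<^bsub>\<beta> + \<pi>/2\<^esub>\<close>
  changes sign under \<open>\<sigma>\<^sub>\<beta>\<close>, hence is orthogonal to \<open>R\<^sub>\<beta>\<close>, and its trace inner product with
  \<open>P\<^sub>\<alpha>\<close> is \<open>sin (\<alpha> - \<beta>)\<close> (\<open>twisted_flip_far\<close>).  Hence the Mashood--Taylor distance of \<open>R\<^sub>\<alpha>\<close> and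
  \<open>R\<^sub>\<beta>\<close> is \<open>\<bar>sin (\<alpha> - \<beta>)\<bar>\<close>, and this takes every value in \<open>[0, 1]\<close>.
\<close>

section \<open>Commutants in the algebra of tensors\<close>

lemma adj_one: "adj 1 = 1"
  by transfer (intro ext, auto)

lemma adj_adj: "adj (adj x) = x"
  by transfer simp

lemma trc_uminus: "trc (- x) = - trc x"
proof -
  have "- x = cscale (- 1) x" by transfer (simp add: fun_eq_iff)
  then show ?thesis by (simp add: trc_cscale)
qed

lemma tensor_alg_eqI: "(\<And>s t. Rep_tensor_alg x s t = Rep_tensor_alg y s t) \<Longrightarrow> x = y"
  by (metis Rep_tensor_alg_inject ext)

lemma finite_row: "finite {r. Rep_tensor_alg x s r \<noteq> 0}"
proof -
  obtain k m where x: "x = of_mat k m" using ex_of_mat by blast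
  have "{r. Rep_tensor_alg x s r \<noteq> 0}
      \<subseteq> (\<lambda>w i. if i < k then w ! i else s i) ` words k"
  proof
    fix r assume "r \<in> {r. Rep_tensor_alg x s r \<noteq> 0}"
    then have "\<forall>i\<ge>k. s i = r i"
      by (auto simp: x of_mat.rep_eq kern_def split: if_splits)
    then have "r = (\<lambda>i. if i < k then map r [0..<k] ! i else s i)"
      by (auto simp: fun_eq_iff)
    then show "r \<in> (\<lambda>w i. if i < k then w ! i else s i) ` words k"
      by (rule image_eqI) (simp add: words_def)
  qed
  then show ?thesis by (rule finite_subset) simp
qed

text \<open>
  In the products with shifted elements and with matrix units, at most one summand of the matrix
  product survives.
\<close>

lemma Rep_mult_single:
  assumes "\<And>r. Rep_tensor_alg x s r \<noteq> 0 \<Longrightarrow> Rep_tensor_alg y r t \<noteq> 0 \<Longrightarrow> r = r0"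
  shows "Rep_tensor_alg (x * y) s t = Rep_tensor_alg x s r0 * Rep_tensor_alg y r0 t"
proof -
  have "Rep_tensor_alg (x * y) s t
      = (\<Sum>r | Rep_tensor_alg x s r \<noteq> 0. if r = r0 then Rep_tensor_alg x s r0 * Rep_tensor_alg y r0 t else 0)"
    unfolding times_tensor_alg.rep_eq kmult_def using assms by (intro sum.cong) auto
  then show ?thesis by (simp add: finite_row)
qed

lemma shift_mult: "shift (x * y) = shift x * shift y"
proof (rule tensor_alg_eqI)
  fix s t :: "nat \<Rightarrow> 'a"
  let ?s = "\<lambda>i. s (Suc i)" and ?t = "\<lambda>i. t (Suc i)"
  have "(\<Sum>r | (if s 0 = r 0 then Rep_tensor_alg x ?s (\<lambda>i. r (Suc i)) else 0) \<noteq> 0.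
        (if s 0 = r 0 then Rep_tensor_alg x ?s (\<lambda>i. r (Suc i)) else 0) *
        (if r 0 = t 0 then Rep_tensor_alg y (\<lambda>i. r (Suc i)) ?t else 0))
      = (\<Sum>r | Rep_tensor_alg x ?s r \<noteq> 0.
        if s 0 = t 0 then Rep_tensor_alg x ?s r * Rep_tensor_alg y r ?t else 0)"
    by (rule sum.reindex_bij_witness[where i = "\<lambda>r. case_nat (s 0) r" and j = "\<lambda>r i. r (Suc i)"])
       (auto split: nat.splits if_splits)
  then show "Rep_tensor_alg (shift (x * y)) s t = Rep_tensor_alg (shift x * shift y) s t"
    by (simp add: shift.rep_eq times_tensor_alg.rep_eq kmult_def)
qed

lemma shift_one: "shift 1 = 1"
proof (rule tensor_alg_eqI)
  fix s t :: "nat \<Rightarrow> 'a"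
  have "s = t \<longleftrightarrow> s 0 = t 0 \<and> (\<lambda>i. s (Suc i)) = (\<lambda>i. t (Suc i))"
    by (auto simp: fun_eq_iff) (metis not0_implies_Suc)
  then show "Rep_tensor_alg (shift 1) s t = Rep_tensor_alg 1 s t"
    by (simp add: shift.rep_eq one_tensor_alg.rep_eq)
qed

lemma shift_add: "shift (x + y) = shift x + shift y"
  by transfer (auto simp: fun_eq_iff)

lemma shift_cscale: "shift (cscale c x) = cscale c (shift x)"
  by transfer (simp add: fun_eq_iff)

lemma shift_adj: "shift (adj x) = adj (shift x)"
  by transfer (simp add: fun_eq_iff)

lemma shift_power_mult: "(shift ^^ k) (x * y) = (shift ^^ k) x * (shift ^^ k) y"
  and shift_power_one: "(shift ^^ k) 1 = 1"
  and shift_power_add: "(shift ^^ k) (x + y) = (shift ^^ k) x + (shift ^^ k) y"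
  and shift_power_cscale: "(shift ^^ k) (cscale c x) = cscale c ((shift ^^ k) x)"
  and shift_power_adj: "(shift ^^ k) (adj x) = adj ((shift ^^ k) x)"
  by (induction k) (simp_all add: shift_mult shift_one shift_add shift_cscale shift_adj)

lemma Rep_shift_power:
  "Rep_tensor_alg ((shift ^^ k) x) s t =
    (if \<forall>i<k. s i = t i then Rep_tensor_alg x (\<lambda>i. s (k + i)) (\<lambda>i. t (k + i)) else 0)"
  by (induction k arbitrary: s t) (auto simp: shift.rep_eq All_less_Suc2)

lemma level_mult: "x \<in> level k \<Longrightarrow> y \<in> level k \<Longrightarrow> x * y \<in> level k"
  by (auto simp: level_def of_mat_mult)

lemma level_adj: "x \<in> level k \<Longrightarrow> adj x \<in> level k"
  by (auto simp: level_def of_mat_adj)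

lemma level_one: "1 \<in> level k"
  by (metis level_def of_mat_one rangeI)

lemma tensor_level: "tensor xs \<in> level (length xs)"
  by (simp add: tensor_def level_def)

lemma shift_of_mat:
  "shift (of_mat k m) = of_mat (Suc k) (\<lambda>v w. if hd v = hd w then m (tl v) (tl w) else 0)"
proof (rule tensor_alg_eqI)
  fix s t :: "nat \<Rightarrow> 'a"
  have 1: "(\<forall>i\<ge>Suc k. s i = t i) \<longleftrightarrow> (\<forall>i\<ge>k. s (Suc i) = t (Suc i))"
    by (metis Suc_le_D Suc_le_mono)
  have 2: "map s [0..<Suc k] = s 0 # map (\<lambda>i. s (Suc i)) [0..<k]" for s :: "nat \<Rightarrow> 'a"
    by (simp add: upt_conv_Cons map_Suc_upt[symmetric] del: upt_Suc)
  show "Rep_tensor_alg (shift (of_mat k m)) s t = Rep_tensor_alg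
      (of_mat (Suc k) (\<lambda>v w. if hd v = hd w then m (tl v) (tl w) else 0)) s t"
    unfolding shift.rep_eq of_mat.rep_eq kern_def 1 2 by auto
qed

lemma shift_level: "x \<in> level k \<Longrightarrow> shift x \<in> level (Suc k)"
  by (auto simp: level_def shift_of_mat)

lemma shift_power_level: "x \<in> level l \<Longrightarrow> (shift ^^ k) x \<in> level (k + l)"
  by (induction k) (auto intro: shift_level)

text \<open>
  The two factors act on disjoint sets of sites, the first \<open>k\<close> and the remaining ones.
\<close>

lemma level_commute_shift:
  assumes "x \<in> level k" shows "x * (shift ^^ k) y = (shift ^^ k) y * x"
proof (rule tensor_alg_eqI)
  fix s t :: "nat \<Rightarrow> 'a"
  obtain m where x: "x = of_mat k m" using assms by (auto simp: level_def)
  \<comment> \<open>the only intermediate words along which the two products can pass from \<open>s\<close> to \<open>t\<close>\<close>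
  define r where "r = (\<lambda>i. if i < k then t i else s i)"
  define r' where "r' = (\<lambda>i. if i < k then s i else t i)"
  have maps: "map r [0..<k] = map t [0..<k]" "map r' [0..<k] = map s [0..<k]"
    by (auto simp: r_def r'_def)
  have "Rep_tensor_alg (x * (shift ^^ k) y) s t
      = Rep_tensor_alg x s r * Rep_tensor_alg ((shift ^^ k) y) r t"
    by (rule Rep_mult_single)
       (auto simp: x r_def of_mat.rep_eq kern_def Rep_shift_power fun_eq_iff split: if_splits)
  moreover have "Rep_tensor_alg ((shift ^^ k) y * x) s t
      = Rep_tensor_alg ((shift ^^ k) y) s r' * Rep_tensor_alg x r' t"
    by (rule Rep_mult_single)
       (auto simp: x r'_def of_mat.rep_eq kern_def Rep_shift_power fun_eq_iff split: if_splits)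
  moreover have "Rep_tensor_alg x s r = m (map s [0..<k]) (map t [0..<k])"
    "Rep_tensor_alg x r' t = m (map s [0..<k]) (map t [0..<k])"
    unfolding x of_mat.rep_eq kern_def maps by (simp_all add: r_def r'_def)
  moreover have "Rep_tensor_alg ((shift ^^ k) y) r t = Rep_tensor_alg ((shift ^^ k) y) s r'"
    by (simp add: Rep_shift_power r_def r'_def)
  ultimately show "Rep_tensor_alg (x * (shift ^^ k) y) s t = Rep_tensor_alg ((shift ^^ k) y * x) s t"
    by simp
qed

lemma Rep_site_unit:
  "Rep_tensor_alg ((shift ^^ k) (tensor [matrix_unit a b])) s t =
    (if s k = a \<and> t k = b \<and> (\<forall>i. i \<noteq> k \<longrightarrow> s i = t i) then 1 else 0)"
proof -
  have "(\<forall>i. i \<noteq> k \<longrightarrow> s i = t i) \<longleftrightarrow> (\<forall>i<k. s i = t i) \<and> (\<forall>i\<ge>Suc 0. s (k + i) = t (k + i))"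
  proof safe
    fix i assume *: "\<forall>i<k. s i = t i" "\<forall>i\<ge>Suc 0. s (k + i) = t (k + i)" "i \<noteq> k"
    show "s i = t i"
      using *(1) *(2)[rule_format, of "i - k"] *(3) by (cases "i < k") auto
  qed auto
  then show ?thesis
    by (auto simp: Rep_shift_power tensor_def of_mat.rep_eq kern_def matrix_unit_def)
qed

text \<open>
  The relative commutant of the last tensor factor in \<open>level (Suc k)\<close> is \<open>level k\<close>: commuting with
  the diagonal matrix units at site \<open>k\<close> makes \<open>x\<close> block diagonal in that site, and commuting with
  the off-diagonal ones makes all the blocks equal.
\<close>

lemma level_if_commutes_with_site:
  assumes x: "x \<in> level (Suc k)"
    and comm: "\<And>a b. x * (shift ^^ k) (tensor [matrix_unit a b])
      = (shift ^^ k) (tensor [matrix_unit a b]) * x"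
  shows "x \<in> level k"
proof -
  have unit: "(if t k = b then Rep_tensor_alg x s (t(k := a)) else 0)
      = (if s k = a then Rep_tensor_alg x (s(k := b)) t else 0)" for a b s t
  proof -
    have "Rep_tensor_alg (x * (shift ^^ k) (tensor [matrix_unit a b])) s t
        = Rep_tensor_alg x s (t(k := a))
          * Rep_tensor_alg ((shift ^^ k) (tensor [matrix_unit a b])) (t(k := a)) t"
      by (rule Rep_mult_single) (auto simp: Rep_site_unit fun_eq_iff split: if_splits)
    moreover have "Rep_tensor_alg ((shift ^^ k) (tensor [matrix_unit a b]) * x) s t
        = Rep_tensor_alg ((shift ^^ k) (tensor [matrix_unit a b])) s (s(k := b))
          * Rep_tensor_alg x (s(k := b)) t"
      by (rule Rep_mult_single) (auto simp: Rep_site_unit fun_eq_iff split: if_splits)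
    ultimately show ?thesis
      using comm[of a b] by (auto simp: Rep_site_unit split: if_splits)
  qed
  have diag: "Rep_tensor_alg x s t = 0" if "s k \<noteq> t k" for s t
    using unit[where s = s and t = t and a = "t k" and b = "t k"] that by simp
  have const: "Rep_tensor_alg x s t = Rep_tensor_alg x (s(k := b)) (t(k := b))"
    if "s k = t k" for s t b
    using unit[of "t(k := b)" b s "t k"] that by simp
  obtain m where m: "x = of_mat (Suc k) m" using x by (auto simp: level_def)
  \<comment> \<open>any letter serves, because all the diagonal blocks agree\<close>
  define c :: 'a where "c = undefined"
  have "x = of_mat k (\<lambda>v w. m (v @ [c]) (w @ [c]))"
  proof (rule tensor_alg_eqI)
    fix s t :: "nat \<Rightarrow> 'a"
    have upd: "map (s(k := c)) [0..<k] = map s [0..<k]" for s :: "nat \<Rightarrow> 'a"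
      by auto
    have iff: "(\<forall>i\<ge>k. s i = t i) \<longleftrightarrow> s k = t k \<and> (\<forall>i\<ge>Suc k. s i = t i)"
      by (metis Suc_leD Suc_leI le_neq_implies_less order_refl)
    show "Rep_tensor_alg x s t
        = Rep_tensor_alg (of_mat k (\<lambda>v w. m (v @ [c]) (w @ [c]))) s t"
    proof (cases "s k = t k")
      case True
      show ?thesis
        unfolding const[of s t c, OF True] unfolding m of_mat.rep_eq kern_def using True
        by (auto simp: upd iff)
    next
      case False
      then show ?thesis by (auto simp: diag of_mat.rep_eq kern_def)
    qed
  qed
  then show ?thesis by (auto simp: level_def)
qed


section \<open>Operators on the GNS space\<close>

lemma blinfun_eq_on_embed:
  fixes S T :: "'a::real_inner completion \<Rightarrow>\<^sub>L 'b::real_normed_vector"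
  assumes "\<And>x. blinfun_apply S (embed x) = blinfun_apply T (embed x)"
  shows "S = T"
proof (rule blinfun_eqI)
  fix \<xi> :: "'a completion"
  obtain X where X: "(\<lambda>n. embed (X n)) \<longlonglongrightarrow> \<xi>" using embed_dense by blast
  have "(\<lambda>n. S (embed (X n))) \<longlonglongrightarrow> S \<xi>" "(\<lambda>n. T (embed (X n))) \<longlonglongrightarrow> T \<xi>"
    by (intro tendsto_intros X)+
  then show "S \<xi> = T \<xi>" using assms LIMSEQ_unique by simp
qed

lemma gns_rep_mult: "gns_rep (a * b) = gns_rep a o\<^sub>L gns_rep b"
  by (rule blinfun_eq_on_embed) (simp add: gns_rep_embed mult.assoc)

lemma gns_rep_one: "gns_rep 1 = id_blinfun"
  by (rule blinfun_eq_on_embed) (simp add: gns_rep_embed)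

lemma gns_rep_add: "gns_rep (a + b) = gns_rep a + gns_rep b"
  by (rule blinfun_eq_on_embed)
     (simp add: gns_rep_embed embed_add distrib_right blinfun.add_left)

lemma gns_rep_scaleR: "gns_rep (r *\<^sub>R a) = r *\<^sub>R gns_rep a"
  by (rule blinfun_eq_on_embed)
     (simp add: gns_rep_embed blinfun.scaleR_left scaleR_eq_cscale cscale_mult_left
       flip: embed_scaleR)

lemma inner_gns_rep: "inner (gns_rep a \<xi>) \<eta> = inner \<xi> (gns_rep (adj a) \<eta>)"
proof -
  obtain X where X: "(\<lambda>n. embed (X n)) \<longlonglongrightarrow> \<xi>" using embed_dense by blast
  obtain Y where Y: "(\<lambda>n. embed (Y n)) \<longlonglongrightarrow> \<eta>" using embed_dense by blast
  have "(\<lambda>n. inner (gns_rep a (embed (X n))) (embed (Y n))) \<longlonglongrightarrow> inner (gns_rep a \<xi>) \<eta>"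
    by (intro tendsto_intros X Y)
  moreover have "(\<lambda>n. inner (embed (X n)) (gns_rep (adj a) (embed (Y n))))
      \<longlonglongrightarrow> inner \<xi> (gns_rep (adj a) \<eta>)"
    by (intro tendsto_intros X Y)
  ultimately show ?thesis
    using LIMSEQ_unique by (simp add: gns_rep_embed inner_embed inner_mult_left_adj)
qed

lemma cinner_gns_rep_left: "cinner (gns_rep a \<xi>) \<eta> = cinner \<xi> (gns_rep (adj a) \<eta>)"
proof -
  have "gns_rep (adj a) (scaleC \<i> \<eta>) = scaleC \<i> (gns_rep (adj a) \<eta>)"
    using gns_rep_bounded_operators[of "adj a"] by (simp add: bounded_operators_def)
  then show ?thesis by (simp add: cinner_def inner_gns_rep)
qed

lemma cinner_add_left: "cinner (\<xi> + \<xi>') \<eta> = cinner \<xi> \<eta> + cinner \<xi>' \<eta>"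
  by (simp add: cinner_def inner_add_left complex_eq_iff)

lemma cinner_scaleR_left: "cinner (r *\<^sub>R \<xi>) \<eta> = of_real r * cinner \<xi> \<eta>"
  by (simp add: cinner_def complex_eq_iff)

lemma norm_gns_rep_apply:
  assumes "adj w * w = 1" shows "norm (gns_rep w \<xi>) = norm \<xi>"
proof -
  have "gns_rep (adj w) (gns_rep w \<xi>) = \<xi>"
    using assms by (metis blinfun_apply_blinfun_compose gns_rep_mult gns_rep_one
        blinfun_apply_id_blinfun id_apply)
  then show ?thesis by (simp add: norm_eq_sqrt_inner inner_gns_rep)
qed

lemma norm_gns_rep_le:
  assumes "adj w * w = 1" shows "norm (gns_rep w) \<le> 1"
  by (rule norm_blinfun_bound) (simp_all add: norm_gns_rep_apply[OF assms])

lemma norm_gns_vec: "norm gns_vec = 1"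
  unfolding gns_vec_def norm_embed
  by (simp add: norm_eq_sqrt_inner inner_tensor_alg_def sesq_def trc_one adj_one)

lemma bounded_operators_diff:
  "S \<in> bounded_operators \<Longrightarrow> T \<in> bounded_operators \<Longrightarrow> S - T \<in> bounded_operators"
  by (simp add: bounded_operators_def blinfun.diff_left scaleC_def blinfun.diff_right)

lemma trace_norm_diff:
  assumes "S \<in> bounded_operators" "T \<in> bounded_operators"
  shows "trace_norm (S - T) = norm (S gns_vec - T gns_vec)"
  using trace_norm_eq[OF bounded_operators_diff[OF assms]] by (simp add: blinfun.diff_left)

lemma continuous_map_weak_operator:
  "continuous_map weak_operator_topology euclidean (\<lambda>T. cinner (blinfun_apply T \<xi>) \<eta>)"
proof -
  have "continuous_map weak_operator_topology euclidean
      ((\<lambda>f. f (\<xi>, \<eta>)) \<circ> (\<lambda>T (\<xi>, \<eta>). cinner (blinfun_apply T \<xi>) \<eta>))"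
    unfolding weak_operator_topology_def
    by (intro continuous_map_pullback) (simp add: continuous_on_product_coordinates)
  then show ?thesis by (simp add: o_def)
qed

lemma continuous_map_into_weak_operator:
  assumes "\<And>T. T \<in> topspace X \<Longrightarrow> f T \<in> bounded_operators"
    and "\<And>\<xi> \<eta>. continuous_map X euclidean (\<lambda>T. cinner (blinfun_apply (f T) \<xi>) \<eta>)"
  shows "continuous_map X weak_operator_topology f"
  unfolding weak_operator_topology_def
proof (rule continuous_map_pullback')
  have "continuous_map X (product_topology (\<lambda>_. euclidean) UNIV)
      ((\<lambda>T (\<xi>, \<eta>). cinner (blinfun_apply T \<xi>) \<eta>) \<circ> f)"
    unfolding continuous_map_componentwise_UNIV using assms(2) by (auto simp: o_def)
  then show "continuous_map X euclidean ((\<lambda>T (\<xi>, \<eta>). cinner (blinfun_apply T \<xi>) \<eta>) \<circ> f)"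
    by (simp add: euclidean_product_topology)
qed (use assms(1) in blast)

text \<open>
  Matrix coefficients are weakly continuous, and points of the plane are closed.
\<close>

lemma weak_closure_eqI:
  assumes "T \<in> weak_operator_topology closure_of A"
    and "\<And>S. S \<in> A \<Longrightarrow> cinner (blinfun_apply S \<xi>) \<eta> = c"
  shows "cinner (blinfun_apply T \<xi>) \<eta> = c"
proof -
  have "(\<lambda>T. cinner (blinfun_apply T \<xi>) \<eta>) ` (weak_operator_topology closure_of A)
      \<subseteq> euclidean closure_of ((\<lambda>T. cinner (blinfun_apply T \<xi>) \<eta>) ` A)"
    using continuous_map_weak_operator[of \<xi> \<eta>] by (rule continuous_map_image_closure_subset)
  also have "\<dots> \<subseteq> euclidean closure_of {c}"
    using assms(2) by (intro closure_of_mono) blast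
  also have "\<dots> = {c}" by simp
  finally show ?thesis using assms(1) by blast
qed

text \<open>
  Averaging with an inner conjugation is weakly continuous, because the coefficient of
  \<open>w T w\<^sup>*\<close> at \<open>(\<xi>, \<eta>)\<close> is that of \<open>T\<close> at \<open>(w\<^sup>* \<xi>, w\<^sup>* \<eta>)\<close>.  So it suffices to know what it does on
  the dense subalgebra.  For \<open>w\<close> implementing the quotient of two symmetries, it agrees on the
  fixed points of one of them with the conditional expectation onto the fixed points of the other.
\<close>

lemma conjugation_average_weak_closure:
  assumes "\<And>a. a \<in> A \<Longrightarrow> (1/2) *\<^sub>R (a + w * a * adj w) \<in> B"
    and T: "T \<in> weak_operator_topology closure_of (gns_rep ` A)"
  shows "(1/2) *\<^sub>R (T + (gns_rep w o\<^sub>L T o\<^sub>L gns_rep (adj w)))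
    \<in> weak_operator_topology closure_of (gns_rep ` B)"
proof -
  define f where "f = (\<lambda>T. (1/2) *\<^sub>R (T + (gns_rep w o\<^sub>L T o\<^sub>L gns_rep (adj w))))"
  have "continuous_map weak_operator_topology weak_operator_topology f"
  proof (rule continuous_map_into_weak_operator)
    fix T :: "'a gns \<Rightarrow>\<^sub>L 'a gns" assume "T \<in> topspace weak_operator_topology"
    then have T: "T (scaleC \<i> \<xi>) = scaleC \<i> (T \<xi>)" for \<xi>
      by (simp add: topspace_weak_operator_topology bounded_operators_def)
    have "gns_rep a (scaleC \<i> \<xi>) = scaleC \<i> (gns_rep a \<xi>)" for a :: "'a tensor_alg" and \<xi>
      using gns_rep_bounded_operators[of a] by (simp add: bounded_operators_def)
    then show "f T \<in> bounded_operators"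
      by (simp add: f_def bounded_operators_def blinfun.add_left blinfun.scaleR_left T)
         (simp add: scaleC_def blinfun.add_right blinfun.scaleR_right)
  next
    fix \<xi> \<eta> :: "'a gns"
    have eq: "(\<lambda>T. cinner (f T \<xi>) \<eta>) = (\<lambda>T. of_real (1/2) *
        (cinner (blinfun_apply T \<xi>) \<eta>
          + cinner (blinfun_apply T (gns_rep (adj w) \<xi>)) (gns_rep (adj w) \<eta>)))"
      by (simp add: f_def fun_eq_iff blinfun.add_left blinfun.scaleR_left cinner_add_left
          cinner_scaleR_left cinner_gns_rep_left)
    have "((\<lambda>T. cinner (blinfun_apply T \<xi>) \<eta>) \<longlongrightarrow> cinner (blinfun_apply T \<xi>) \<eta>)
        (atin weak_operator_topology T)" if "T \<in> topspace weak_operator_topology"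
      for T and \<xi> \<eta> :: "'a gns"
      using continuous_map_weak_operator[of \<xi> \<eta>] that
      unfolding continuous_map_atin limitin_canonical_iff by blast
    then show "continuous_map weak_operator_topology euclidean (\<lambda>T. cinner (f T \<xi>) \<eta>)"
      unfolding eq continuous_map_atin limitin_canonical_iff
      by (intro ballI tendsto_mult tendsto_add tendsto_const)
  qed
  then have "f ` (weak_operator_topology closure_of (gns_rep ` A))
      \<subseteq> weak_operator_topology closure_of (f ` gns_rep ` A)"
    by (rule continuous_map_image_closure_subset)
  also have "f ` gns_rep ` A \<subseteq> gns_rep ` B"
  proof
    fix S assume "S \<in> f ` gns_rep ` A"
    then obtain a where "a \<in> A" "S = f (gns_rep a)" by blast
    then show "S \<in> gns_rep ` B"
      using assms(1) by (auto simp: f_def gns_rep_mult gns_rep_add gns_rep_scaleR intro!: image_eqI)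
  qed
  then have "weak_operator_topology closure_of (f ` gns_rep ` A)
      \<subseteq> weak_operator_topology closure_of (gns_rep ` B)"
    by (rule closure_of_mono)
  finally show ?thesis using T by (auto simp: f_def)
qed


section \<open>The spin model unitary\<close>

lemma words_Suc_iff: "w \<in> words (Suc k) \<longleftrightarrow> (\<exists>a v. w = a # v \<and> v \<in> words k)"
  by (auto simp: words_def length_Suc_conv)

lemma of_mat_1_eq_iff: "of_mat 1 m = of_mat 1 m' \<longleftrightarrow> (\<forall>a b. m [a] [b] = m' [a] [b])"
  by (auto simp: of_mat_eq_iff words_Suc_iff words_0)

lemma mmult_1: "mmult 1 m m' v w = (\<Sum>a\<in>UNIV. m v [a] * m' [a] w)"
  by (simp add: mmult_def sum_words_Suc words_0)

lemma of_mat_2_eq_iff: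
  "of_mat 2 m = of_mat 2 m' \<longleftrightarrow> (\<forall>a b c d. m [a, b] [c, d] = m' [a, b] [c, d])"
  by (auto simp: of_mat_eq_iff eval_nat_numeral words_Suc_iff words_0)

lemma mmult_2: "mmult 2 m m' v w = (\<Sum>a\<in>UNIV. \<Sum>b\<in>UNIV. m v [a, b] * m' [a, b] w)"
  by (simp add: mmult_def eval_nat_numeral sum_words_Suc words_0)

lemma of_mat_sum:
  assumes "finite I" shows "(\<Sum>i\<in>I. of_mat k (f i)) = of_mat k (\<lambda>v w. \<Sum>i\<in>I. f i v w)"
  using assms by induction (simp_all add: of_mat_add flip: of_mat_zero)

lemma tensor_single: "tensor [A] = of_mat 1 (\<lambda>v w. A $ hd v $ hd w)"
  by (auto simp: tensor_def of_mat_eq_iff words_Suc_iff words_0)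

lemma tensor_single_level: "tensor [A] \<in> level (Suc k)"
  using tensor_level[of "[A]"] level_mono[of 1 "Suc k"] by auto

lemma tensor_single_2:
  "tensor [A] = of_mat 2 (\<lambda>v w. if v ! 1 = w ! 1 then A $ (v ! 0) $ (w ! 0) else 0)"
  unfolding tensor_single of_mat_raise[of 1] Suc_1[unfolded One_nat_def[symmetric]]
  by (simp add: raise_def of_mat_2_eq_iff)

lemma shift_tensor_single:
  "shift (tensor [A]) = of_mat 2 (\<lambda>v w. if v ! 0 = w ! 0 then A $ (v ! 1) $ (w ! 1) else 0)"
  unfolding tensor_single shift_of_mat Suc_1[unfolded One_nat_def[symmetric]]
  by (simp add: of_mat_2_eq_iff)

lemma tensor_pair:
  "tensor [A, B] = of_mat 2 (\<lambda>v w. A $ (v ! 0) $ (w ! 0) * B $ (v ! 1) $ (w ! 1))"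
  by (simp add: tensor_def eval_nat_numeral)

lemma tensor_single_mult: "tensor [A] * tensor [B] = tensor [A ** B]"
  by (auto simp: tensor_single of_mat_mult of_mat_eq_iff mmult_def matrix_matrix_mult_def
      words_Suc_iff words_0 sum_words_Suc)

lemma tensor_single_add: "tensor [A] + tensor [B] = tensor [A + B]"
  by (simp add: tensor_single of_mat_add)

lemma tensor_single_uminus: "tensor [- A] = - tensor [A]"
  by (simp add: tensor_single of_mat_uminus)

lemma tensor_single_scaleR: "r *\<^sub>R tensor [A] = tensor [r *\<^sub>R A]"
  unfolding tensor_single scaleR_eq_cscale of_mat_cscale by (simp add: scaleR_conv_of_real[symmetric])

lemma tensor_single_one: "tensor [mat 1] = 1"
  unfolding of_mat_one[of 1] by (auto simp: tensor_single of_mat_eq_iff words_Suc_iff words_0 mat_def)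

lemma adj_tensor_single: "adj (tensor [A]) = tensor [matrix_adj A]"
  by (simp add: tensor_single of_mat_adj matrix_adj_def)

lemma trc_tensor_single: "trc (tensor [A :: complex^'n::finite^'n]) = trace A / of_nat CARD('n)"
  by (simp add: tensor_single trc_of_mat mtr_def trace_def words_0 sum_words_Suc)

lemma sum_sum_delta:
  "(\<Sum>a\<in>(UNIV::'a::finite set). \<Sum>b\<in>(UNIV::'b::finite set).
    if a = c \<and> b = d then f a b else 0) = f c d"
proof -
  have "(\<Sum>a\<in>UNIV. \<Sum>b\<in>UNIV. if a = c \<and> b = d then f a b else 0)
      = (\<Sum>a\<in>UNIV. \<Sum>b\<in>UNIV. if b = d then (if a = c then f a b else 0) else 0)"
    by (intro sum.cong) auto
  then show ?thesis by simp
qed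

text \<open>
  The unitary acts on the first site only, with the second site as a control; this is the
  statement \<open>u\<^sub>1 \<in> M\<^sub>n \<otimes> \<Delta>\<close> in coordinates.
\<close>

lemma spin_u1_of_mat:
  "spin_u1 (u :: complex^'n::finite^'n) = of_mat 2 (\<lambda>v w. if v ! 1 = w ! 1
    then of_real (sqrt (real CARD('n))) * u $ (v ! 0) $ (w ! 0) * cnj (u $ (w ! 1) $ (w ! 0)) else 0)"
proof -
  have "spin_diag u = of_mat 2 (\<lambda>v w. if v = w
      then of_real (sqrt (real CARD('n))) * cnj (u $ (w ! 1) $ (w ! 0)) else 0)"
  proof -
    have "(\<Sum>i\<in>UNIV. \<Sum>j\<in>UNIV. cnj (u $ i $ j) * (matrix_unit j j $ a $ c * matrix_unit i i $ b $ d))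
        = (if a = c \<and> b = d then cnj (u $ d $ c) else 0)" for a b c d :: 'n
    proof -
      have "(\<Sum>i\<in>UNIV. \<Sum>j\<in>UNIV. cnj (u $ i $ j) * (matrix_unit j j $ a $ c * matrix_unit i i $ b $ d))
        = (\<Sum>i\<in>UNIV. \<Sum>j\<in>UNIV. if j = a
              then (if i = b then (if a = c \<and> b = d then cnj (u $ i $ j) else 0) else 0) else 0)"
        by (intro sum.cong) (auto simp: matrix_unit_def)
      then show ?thesis by simp
    qed
    then show ?thesis
      by (simp add: spin_diag_def tensor_pair of_mat_cscale of_mat_sum of_mat_2_eq_iff)
  qed
  then show ?thesis
    by (simp add: spin_u1_def tensor_pair of_mat_mult of_mat_2_eq_iff mmult_2 mat_def
        if_distrib[of "\<lambda>c. _ * c"] if_distrib[of "\<lambda>c. c * _"] mult_ac sum_sum_delta cong: if_cong)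
qed

text \<open>
  In \<open>u\<^sub>1\<^sup>* u\<^sub>1\<close> orthonormality of the columns of \<open>u\<close> produces the factor \<open>\<delta>\<^sub>a\<^sub>c\<close>, in \<open>u\<^sub>1 u\<^sub>1\<^sup>*\<close>
  orthonormality of the rows; the diagonal factor cancels because \<open>\<surd>n u\<^sub>i\<^sub>j\<close> has modulus one.
\<close>

lemma spin_u1_unitary:
  fixes u :: "complex^'n::finite^'n"
  assumes "hadamard_unitary u"
  shows "adj (spin_u1 u) * spin_u1 u = 1" "spin_u1 u * adj (spin_u1 u) = 1"
proof -
  let ?n = "complex_of_real (sqrt (real CARD('n)))"
  have n: "?n * ?n = of_nat CARD('n)"
    by (simp flip: of_real_mult)
  have col: "(\<Sum>e\<in>UNIV. cnj (u $ e $ a) * u $ e $ c) = (if a = c then 1 else 0)" for a c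
    using assms by (simp add: hadamard_unitary_def matrix_adj_def matrix_matrix_mult_def mat_def vec_eq_iff)
  have row: "(\<Sum>e\<in>UNIV. u $ a $ e * cnj (u $ c $ e)) = (if a = c then 1 else 0)" for a c
    using assms by (simp add: hadamard_unitary_def matrix_adj_def matrix_matrix_mult_def mat_def vec_eq_iff)
  have modulus: "of_nat CARD('n) * (u $ a $ b * cnj (u $ a $ b)) = 1" for a b
    using assms by (simp add: hadamard_unitary_def power_divide flip: complex_norm_square)
  have delta: "(\<Sum>f\<in>UNIV. (if f = b then p f else 0) * (if f = d then q f else 0))
      = (if b = d then p b * q b else 0)" for b d :: 'n and p q :: "'n \<Rightarrow> complex"
  proof -
    have "(\<Sum>f\<in>UNIV. (if f = b then p f else 0) * (if f = d then q f else 0))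
        = (\<Sum>f\<in>UNIV. if f = b then (if b = d then p f * q f else 0) else 0)"
      by (intro sum.cong) auto
    then show ?thesis by simp
  qed
  have "(\<Sum>e\<in>UNIV. \<Sum>f\<in>UNIV. (if f = b then cnj (?n * u $ e $ a * cnj (u $ b $ a)) else 0)
        * (if f = d then ?n * u $ e $ c * cnj (u $ d $ c) else 0))
      = (if a = c \<and> b = d then 1 else 0)" for a b c d
  proof -
    have "(\<Sum>e\<in>UNIV. \<Sum>f\<in>UNIV. (if f = b then cnj (?n * u $ e $ a * cnj (u $ b $ a)) else 0)
        * (if f = d then ?n * u $ e $ c * cnj (u $ d $ c) else 0))
      = (if b = d then \<Sum>e\<in>UNIV. (?n * ?n * (u $ b $ a * cnj (u $ b $ c)))
          * (cnj (u $ e $ a) * u $ e $ c) else 0)"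
      unfolding delta by (simp add: mult_ac)
    also have "\<dots> = (if a = c \<and> b = d then 1 else 0)"
      unfolding sum_distrib_left[symmetric] col n using modulus by simp
    finally show ?thesis .
  qed
  then show "adj (spin_u1 u) * spin_u1 u = 1"
    unfolding spin_u1_of_mat of_mat_adj of_mat_mult of_mat_one[of 2] of_mat_2_eq_iff mmult_2
    by (simp add: if_distrib[of cnj] cong: if_cong)
  have "(\<Sum>e\<in>UNIV. \<Sum>f\<in>UNIV. (if f = b then ?n * u $ a $ e * cnj (u $ f $ e) else 0)
        * (if f = d then cnj (?n * u $ c $ e * cnj (u $ f $ e)) else 0))
      = (if a = c \<and> b = d then 1 else 0)" for a b c d
  proof -
    have "(\<Sum>e\<in>UNIV. \<Sum>f\<in>UNIV. (if f = b then ?n * u $ a $ e * cnj (u $ f $ e) else 0)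
        * (if f = d then cnj (?n * u $ c $ e * cnj (u $ f $ e)) else 0))
      = (if b = d then \<Sum>e\<in>UNIV. ?n * ?n * (u $ b $ e * cnj (u $ b $ e))
          * (u $ a $ e * cnj (u $ c $ e)) else 0)"
      unfolding delta by (simp add: mult_ac)
    also have "\<dots> = (if a = c \<and> b = d then 1 else 0)"
      unfolding n modulus by (simp add: row)
    finally show ?thesis .
  qed
  then show "spin_u1 u * adj (spin_u1 u) = 1"
    unfolding spin_u1_of_mat of_mat_adj of_mat_mult of_mat_one[of 2] of_mat_2_eq_iff mmult_2
    by (simp add: if_distrib[of cnj] eq_commute[of _ "_ ! _"] eq_commute cong: if_cong)
qed

lemma spin_u1_level: "spin_u1 u \<in> level 2"
  by (simp add: spin_u1_of_mat level_def)

lemma spin_unitary_Suc: "spin_unitary u (Suc k) = spin_unitary u k * (shift ^^ k) (spin_u1 u)"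
  by (simp add: spin_unitary_def)

lemma spin_unitary_level: "spin_unitary u k \<in> level (Suc k)"
proof (induction k)
  case 0
  show ?case by (simp add: spin_unitary_def level_one)
next
  case (Suc k)
  then have "spin_unitary u k \<in> level (Suc (Suc k))"
    using level_mono[of "Suc k" "Suc (Suc k)"] by auto
  moreover have "(shift ^^ k) (spin_u1 u) \<in> level (Suc (Suc k))"
    using shift_power_level[OF spin_u1_level, of k u] by simp
  ultimately show ?case by (simp add: spin_unitary_Suc level_mult)
qed

lemma spin_unitary_unitary:
  assumes "hadamard_unitary u"
  shows "adj (spin_unitary u k) * spin_unitary u k = 1
    \<and> spin_unitary u k * adj (spin_unitary u k) = 1"
proof (induction k)
  case 0
  show ?case by (simp add: spin_unitary_def adj_one)
next
  case (Suc k)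
  let ?U = "spin_unitary u k" and ?G = "(shift ^^ k) (spin_u1 u)"
  have G: "adj ?G * ?G = 1" "?G * adj ?G = 1"
    using spin_u1_unitary[OF assms]
    by (simp_all flip: shift_power_adj shift_power_mult add: shift_power_one)
  have "adj (?U * ?G) * (?U * ?G) = adj ?G * (adj ?U * ?U) * ?G"
    "(?U * ?G) * adj (?U * ?G) = ?U * (?G * adj ?G) * adj ?U"
    by (simp_all add: adj_mult mult.assoc)
  then show ?case using Suc G by (simp add: spin_unitary_Suc)
qed

section \<open>Two-by-two Hadamard unitaries and the twisted flip\<close>

text \<open>
  The product \<open>diag(1, e\<^sup>i\<^sup>\<theta>) F\<close> of a diagonal unitary with the Fourier matrix.
\<close>

definition phase_hadamard :: "real \<Rightarrow> complex^2^2"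
  where "phase_hadamard \<theta> = (\<chi> i j. (if i = 1 then 1 else cis \<theta>)
    * (if i = 2 \<and> j = 2 then - 1 else 1) / of_real (sqrt 2))"

text \<open>
  The conjugate \<open>D X D\<^sup>*\<close> of the Pauli matrix \<open>X\<close> by \<open>D = diag(1, e\<^sup>i\<^sup>\<theta>)\<close>; at \<open>\<theta> = 0\<close> it is \<open>X\<close>.
\<close>

definition twisted_flip :: "real \<Rightarrow> complex^2^2"
  where "twisted_flip \<theta> = (\<chi> i j. if i = j then 0 else if i = 1 then cis (- \<theta>) else cis \<theta>)"

text \<open>
  The Pauli matrix \<open>Z\<close>.
\<close>

definition sign_flip :: "complex^2^2"
  where "sign_flip = (\<chi> i j. if i \<noteq> j then 0 else if i = 1 then 1 else - 1)"

lemma hadamard_unitary_phase_hadamard: "hadamard_unitary (phase_hadamard \<theta>)"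
  by (auto simp: hadamard_unitary_def phase_hadamard_def matrix_adj_def matrix_matrix_mult_def
      mat_def vec_eq_iff forall_2 sum_2 norm_divide norm_mult cis_cnj cis_mult field_simps
      simp flip: of_real_mult)

lemma twisted_flip_mult:
  "twisted_flip \<alpha> ** twisted_flip \<beta> =
    (\<chi> i j. if i \<noteq> j then 0 else if i = 1 then cis (\<beta> - \<alpha>) else cis (\<alpha> - \<beta>))"
  by (auto simp: twisted_flip_def matrix_matrix_mult_def vec_eq_iff forall_2 sum_2 cis_mult)

lemma twisted_flip_square: "twisted_flip \<theta> ** twisted_flip \<theta> = mat 1"
  by (auto simp: twisted_flip_mult mat_def vec_eq_iff)

lemma matrix_adj_twisted_flip: "matrix_adj (twisted_flip \<theta>) = twisted_flip \<theta>"
  by (auto simp: twisted_flip_def matrix_adj_def vec_eq_iff forall_2 cis_cnj)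

text \<open>
  The two-site case of the intertwining relation.  For \<open>\<theta> = 0\<close>, \<open>u\<^sub>1\<close> is a Hadamard gate
  composed with a controlled sign change, and the relation says that \<open>u\<^sub>1\<close> carries \<open>X\<close> on the
  second site to \<open>X \<otimes> X\<close>.  For general \<open>\<theta>\<close>, \<open>u\<^sub>1\<close> is multiplied by \<open>D \<otimes> D\<^sup>*\<close> where
  \<open>D = diag(1, e\<^sup>i\<^sup>\<theta>)\<close>, which twists the flip on the first site and untwists it on the second.
\<close>

lemma twisted_flip_spin_u1:
  fixes \<theta> :: real
  defines "G \<equiv> spin_u1 (phase_hadamard \<theta>)"
  shows "tensor [twisted_flip \<theta>] * shift (tensor [twisted_flip 0]) * G
    = G * shift (tensor [twisted_flip \<theta>])"
  unfolding G_def spin_u1_of_mat shift_tensor_single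
  unfolding tensor_single_2 of_mat_mult of_mat_2_eq_iff mmult_2
  by (simp add: forall_2 sum_2 twisted_flip_def phase_hadamard_def cis_cnj cis_mult)

lemma sign_flip_spin_u1:
  fixes u :: "complex^2^2"
  shows "shift (tensor [sign_flip]) * spin_u1 u = spin_u1 u * shift (tensor [sign_flip])"
  unfolding spin_u1_of_mat shift_tensor_single of_mat_mult of_mat_2_eq_iff mmult_2
  by (simp add: forall_2 sum_2 sign_flip_def)


section \<open>The fixed-point description of the spin model algebra\<close>

text \<open>
  The unitary \<open>P\<^sub>\<theta> \<otimes> X \<otimes> \<dots> \<otimes> X\<close> on the sites \<open>0, \<dots>, k\<close>.  For fixed \<open>x\<close> the conjugates of \<open>x\<close> by
  these unitaries are eventually constant in \<open>k\<close>, and their limit is the symmetry whose fixed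
  points are sought.
\<close>

primrec flip_chain :: "real \<Rightarrow> nat \<Rightarrow> 2 tensor_alg" where
  "flip_chain \<theta> 0 = tensor [twisted_flip \<theta>]"
| "flip_chain \<theta> (Suc k) = flip_chain \<theta> k * (shift ^^ Suc k) (tensor [twisted_flip 0])"

lemma flip_chain_level: "flip_chain \<theta> k \<in> level (Suc k)"
proof (induction k)
  case 0
  show ?case using tensor_single_level[of _ 0] by simp
next
  case (Suc k)
  then have "flip_chain \<theta> k \<in> level (Suc (Suc k))"
    using level_mono[of "Suc k" "Suc (Suc k)"] by auto
  moreover have "(shift ^^ Suc k) (tensor [twisted_flip 0]) \<in> level (Suc (Suc k))"
    using shift_power_level[OF tensor_single_level[of _ 0], of "Suc k"] by simp
  ultimately show ?case by (simp add: level_mult del: funpow.simps)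
qed

lemma tensor_twisted_flip_square: "tensor [twisted_flip \<theta>] * tensor [twisted_flip \<theta>] = 1"
  by (simp add: tensor_single_mult twisted_flip_square tensor_single_one)

lemma flip_chain_square: "flip_chain \<theta> k * flip_chain \<theta> k = 1"
proof (induction k)
  case 0
  show ?case by (simp add: tensor_twisted_flip_square)
next
  case (Suc k)
  let ?X = "(shift ^^ Suc k) (tensor [twisted_flip 0])"
  have "flip_chain \<theta> k * ?X * (flip_chain \<theta> k * ?X)
      = flip_chain \<theta> k * (?X * flip_chain \<theta> k) * ?X"
    by (simp only: mult.assoc)
  also have "\<dots> = (flip_chain \<theta> k * flip_chain \<theta> k) * (?X * ?X)"
    by (simp only: level_commute_shift[OF flip_chain_level, symmetric] mult.assoc)
  also have "?X * ?X = 1"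
    by (simp only: tensor_twisted_flip_square shift_power_one flip: shift_power_mult)
  finally show ?case using Suc by (simp del: funpow.simps)
qed

text \<open>
  Chains with different angles differ at the first site only.  This is why the corresponding
  outer symmetries differ by an inner automorphism from \<open>M\<^sub>2\<close>.
\<close>

lemma flip_chain_change:
  "flip_chain \<beta> k = tensor [twisted_flip \<beta> ** twisted_flip \<alpha>] * flip_chain \<alpha> k"
  by (induction k)
     (simp_all add: mult.assoc tensor_twisted_flip_square flip: tensor_single_mult)

text \<open>
  Each new factor \<open>I\<^sup>\<otimes>\<^sup>k \<otimes> u\<^sub>1\<close> moves the twisted flip one site to the right and absorbs the
  factor \<open>X\<close> that the longer chain has there.
\<close>

lemma flip_chain_intertwines:
  "flip_chain \<theta> k * spin_unitary (phase_hadamard \<theta>) k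
    = spin_unitary (phase_hadamard \<theta>) k * (shift ^^ k) (tensor [twisted_flip \<theta>])"
proof (induction k)
  case 0
  show ?case by (simp add: spin_unitary_def)
next
  case (Suc k)
  let ?U = "spin_unitary (phase_hadamard \<theta>) k"
  let ?G = "(shift ^^ k) (spin_u1 (phase_hadamard \<theta>))"
  let ?P = "\<lambda>k. (shift ^^ k) (tensor [twisted_flip \<theta>])"
  let ?X = "(shift ^^ Suc k) (tensor [twisted_flip 0])"
  have step: "?P k * ?X * ?G = ?G * ?P (Suc k)"
    using arg_cong[OF twisted_flip_spin_u1[of \<theta>], of "shift ^^ k"]
    by (simp add: shift_power_mult funpow_swap1)
  have "flip_chain \<theta> k * ?X * (?U * ?G) = flip_chain \<theta> k * (?X * ?U) * ?G"
    by (simp only: mult.assoc)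
  also have "\<dots> = (flip_chain \<theta> k * ?U) * ?X * ?G"
    by (simp only: level_commute_shift[OF spin_unitary_level, symmetric] mult.assoc)
  also have "\<dots> = ?U * (?P k * ?X * ?G)"
    by (simp only: Suc.IH mult.assoc)
  also have "\<dots> = ?U * ?G * ?P (Suc k)"
    by (subst step) (simp only: mult.assoc)
  finally show ?case by (simp add: spin_unitary_Suc del: funpow.simps)
qed

text \<open>
  The last site is only a control of \<open>u\<^sub>2\<^sub>k\<^sub>-\<^sub>1\<close>, so diagonal matrices there commute with it.
\<close>

lemma sign_flip_commutes_spin_unitary:
  "(shift ^^ k) (tensor [sign_flip]) * spin_unitary u k
    = spin_unitary u k * (shift ^^ k) (tensor [sign_flip])"
proof (cases k)
  case 0
  then show ?thesis by (simp add: spin_unitary_def)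
next
  case (Suc j)
  let ?G = "(shift ^^ j) (spin_u1 u)" and ?Z = "(shift ^^ Suc j) (tensor [sign_flip])"
  have step: "?Z * ?G = ?G * ?Z"
    using arg_cong[OF sign_flip_spin_u1[of u], of "shift ^^ j"]
    by (simp add: shift_power_mult funpow_swap1)
  have "?Z * (spin_unitary u j * ?G) = spin_unitary u j * (?Z * ?G)"
    by (simp only: level_commute_shift[OF spin_unitary_level, symmetric] flip: mult.assoc)
  then show ?thesis
    by (simp only: Suc spin_unitary_Suc step mult.assoc)
qed

text \<open>
  The algebra generated by \<open>Z\<close> and \<open>P\<^sub>\<theta>\<close> is all of \<open>M\<^sub>2\<close>.  The diagonal part of \<open>A\<close> is a combination of
  \<open>I\<close> and \<open>Z\<close>, the off-diagonal part is \<open>P\<^sub>\<theta>\<close> times such a combination.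
\<close>

lemma tensor_single_decompose:
  "tensor [A :: complex^2^2] = cscale ((A $ 1 $ 1 + A $ 2 $ 2) / 2) 1
    + cscale ((A $ 1 $ 1 - A $ 2 $ 2) / 2) (tensor [sign_flip])
    + tensor [twisted_flip \<theta>] * (cscale ((cis (- \<theta>) * A $ 2 $ 1 + cis \<theta> * A $ 1 $ 2) / 2) 1
      + cscale ((cis (- \<theta>) * A $ 2 $ 1 - cis \<theta> * A $ 1 $ 2) / 2) (tensor [sign_flip]))"
proof -
  have cis: "cis \<theta> * (cis (- \<theta>) * z) = z" "cis (- \<theta>) * (cis \<theta> * z) = z" for z
    by (simp_all add: cis_mult flip: mult.assoc)
  show ?thesis
    unfolding tensor_single of_mat_one[of 1] of_mat_cscale of_mat_add of_mat_mult of_mat_1_eq_iff mmult_1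
    by (simp add: forall_2 sum_2 twisted_flip_def sign_flip_def field_simps cis)
qed

text \<open>
  The weakly dense subalgebra of the spin model subfactor.
\<close>

definition spin_algebra :: "complex^'n::finite^'n \<Rightarrow> 'n tensor_alg set"
  where "spin_algebra u =
    (\<Union>k\<in>{1..}. {spin_unitary u k * x * adj (spin_unitary u k) | x. x \<in> level k})"

lemma spin_subfactor_eq:
  "spin_subfactor u = weak_operator_topology closure_of (gns_rep ` spin_algebra u)"
  by (simp add: spin_subfactor_def spin_algebra_def image_UN)

text \<open>
  Conjugation by \<open>U = u\<^sub>2\<^sub>k\<^sub>-\<^sub>1\<close> carries the last-site matrices \<open>P\<^sub>\<theta>\<close> and \<open>Z\<close> to \<open>flip_chain \<theta> k\<close>
  and \<open>Z\<close>.  Elements of \<open>level k\<close> commute with the former, hence their conjugates commute with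
  the chain.  Conversely, if \<open>x\<close> lies in \<open>level k\<close> and commutes with the chain, then \<open>U\<^sup>* x U\<close> commutes
  with \<open>P\<^sub>\<theta>\<close> and \<open>Z\<close>, thus with all matrices at the last site, and so belongs to \<open>level k\<close>.
\<close>

lemma spin_algebra_iff:
  "x \<in> spin_algebra (phase_hadamard \<theta>)
    \<longleftrightarrow> (\<exists>K. \<forall>k\<ge>K. x * flip_chain \<theta> k = flip_chain \<theta> k * x)"
proof
  let ?U = "spin_unitary (phase_hadamard \<theta>)"
  have U: "adj (?U k) * ?U k = 1" "?U k * adj (?U k) = 1" for k
    using spin_unitary_unitary[OF hadamard_unitary_phase_hadamard] by auto
  have adj_U: "adj (?U k) * b = c * adj (?U k)" if "b * ?U k = ?U k * c" for b c k
  proof -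
    have "adj (?U k) * b = adj (?U k) * (b * ?U k) * adj (?U k)"
      by (simp add: mult.assoc U)
    also have "\<dots> = (adj (?U k) * ?U k) * c * adj (?U k)"
      by (simp add: mult.assoc that)
    finally show ?thesis by (simp add: U)
  qed
  let ?P = "\<lambda>k. (shift ^^ k) (tensor [twisted_flip \<theta>])"
  let ?Z = "\<lambda>k. (shift ^^ k) (tensor [sign_flip])"
  note FU = flip_chain_intertwines[of \<theta>]
  note UF = adj_U[OF FU]
  note ZU = sign_flip_commutes_spin_unitary[of _ "phase_hadamard \<theta>"]
  note UZ = adj_U[OF ZU]
  {
    assume "x \<in> spin_algebra (phase_hadamard \<theta>)"
    then obtain k y where x: "x = ?U k * y * adj (?U k)" and y: "y \<in> level k"
      unfolding spin_algebra_def by blast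
    have "x \<in> level (Suc k)"
      unfolding x using y level_mono[of k "Suc k"]
      by (auto intro!: level_mult level_adj spin_unitary_level)
    have "x * flip_chain \<theta> j = flip_chain \<theta> j * x" if "k \<le> j" for j
      using that
    proof (induction j rule: dec_induct)
      case base
      have "x * flip_chain \<theta> k = ?U k * (y * ?P k) * adj (?U k)"
        by (simp add: x mult.assoc UF)
      also have "\<dots> = ?U k * ?P k * y * adj (?U k)"
        by (simp add: level_commute_shift[OF y] mult.assoc)
      also have "\<dots> = flip_chain \<theta> k * x"
        by (simp add: x FU flip: mult.assoc)
      finally show ?case .
    next
      case (step j)
      let ?X = "(shift ^^ Suc j) (tensor [twisted_flip 0])"
      have "x \<in> level (Suc j)"
        using \<open>x \<in> level (Suc k)\<close> step.hyps level_mono[of "Suc k" "Suc j"] by auto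
      then have "x * ?X = ?X * x" by (rule level_commute_shift)
      moreover have "x * (flip_chain \<theta> j * ?X) = (x * flip_chain \<theta> j) * ?X"
        by (simp only: mult.assoc)
      ultimately show ?case by (simp add: step.IH mult.assoc del: funpow.simps)
    qed
    then show "\<exists>K. \<forall>k\<ge>K. x * flip_chain \<theta> k = flip_chain \<theta> k * x" by blast
  }
  assume "\<exists>K. \<forall>k\<ge>K. x * flip_chain \<theta> k = flip_chain \<theta> k * x"
  then obtain K where K: "\<And>k. k \<ge> K \<Longrightarrow> x * flip_chain \<theta> k = flip_chain \<theta> k * x" by blast
  obtain l m where "x = of_mat l m" using ex_of_mat by blast
  then have l: "x \<in> level l" by (simp add: level_def)
  \<comment> \<open>the definition of the algebra starts at level \<open>1\<close>\<close>
  define k where "k = max 1 (max K l)"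
  have "K \<le> k" "l \<le> k" by (simp_all add: k_def)
  then have x: "x \<in> level k" and xF: "x * flip_chain \<theta> k = flip_chain \<theta> k * x"
    using K l level_mono[of l k] by auto
  define y where "y = adj (?U k) * x * ?U k"
  have yP: "y * ?P k = ?P k * y"
  proof -
    have "y * ?P k = adj (?U k) * (x * flip_chain \<theta> k) * ?U k"
      by (simp add: y_def mult.assoc FU)
    also have "\<dots> = ?P k * y"
      by (simp add: xF y_def UF flip: mult.assoc)
    finally show ?thesis .
  qed
  have yZ: "y * ?Z k = ?Z k * y"
  proof -
    have "y * ?Z k = adj (?U k) * (x * ?Z k) * ?U k"
      by (simp add: y_def mult.assoc ZU)
    also have "\<dots> = ?Z k * y"
      by (simp add: level_commute_shift[OF x] y_def UZ flip: mult.assoc)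
    finally show ?thesis .
  qed
  have "y * (shift ^^ k) (tensor [A]) = (shift ^^ k) (tensor [A]) * y" for A
  proof -
    have "y * (?P k * ?Z k) = ?P k * (y * ?Z k)"
      by (simp add: yP flip: mult.assoc)
    then have yPZ: "y * (?P k * ?Z k) = ?P k * (?Z k * y)"
      by (simp only: yZ)
    show ?thesis
      unfolding tensor_single_decompose[of A \<theta>] shift_power_add shift_power_mult shift_power_cscale
        shift_power_one
      by (simp only: distrib_left distrib_right cscale_mult_left cscale_mult_right mult_1_right
          mult_1_left mult.assoc yP yZ yPZ)
  qed
  moreover have "y \<in> level (Suc k)"
    unfolding y_def using x level_mono[of k "Suc k"]
    by (auto intro!: level_mult level_adj spin_unitary_level)
  ultimately have "y \<in> level k" using level_if_commutes_with_site by blast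
  moreover have "x = ?U k * y * adj (?U k)"
  proof -
    have "?U k * y * adj (?U k) = (?U k * adj (?U k)) * x * (?U k * adj (?U k))"
      by (simp only: y_def mult.assoc)
    then show ?thesis by (simp add: U)
  qed
  moreover have "k \<in> {1..}" by (simp add: k_def)
  ultimately show "x \<in> spin_algebra (phase_hadamard \<theta>)"
    unfolding spin_algebra_def by blast
qed


section \<open>The distance between two spin model subfactors\<close>

lemma adj_twisted_flip_product:
  "adj (tensor [twisted_flip \<beta> ** twisted_flip \<alpha>]) = tensor [twisted_flip \<alpha> ** twisted_flip \<beta>]"
  by (simp add: adj_mult adj_tensor_single matrix_adj_twisted_flip flip: tensor_single_mult)

lemma twisted_flip_product_unitary:
  "tensor [twisted_flip \<alpha> ** twisted_flip \<beta>] * tensor [twisted_flip \<beta> ** twisted_flip \<alpha>] = 1"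
proof -
  have "tensor [twisted_flip \<alpha> ** twisted_flip \<beta>] * tensor [twisted_flip \<beta> ** twisted_flip \<alpha>]
      = tensor [twisted_flip \<alpha>] * (tensor [twisted_flip \<beta>] * tensor [twisted_flip \<beta>])
        * tensor [twisted_flip \<alpha>]"
    by (simp only: mult.assoc flip: tensor_single_mult)
  then show ?thesis by (simp add: tensor_twisted_flip_square)
qed

text \<open>
  On elements fixed by the symmetry with angle \<open>\<alpha>\<close>, conjugation by \<open>w\<close> is the symmetry with
  angle \<open>\<beta>\<close>, so the average is the projection to the fixed points of the latter.
\<close>

lemma conjugation_average_spin_algebra:
  fixes \<alpha> \<beta> :: real
  assumes "x \<in> spin_algebra (phase_hadamard \<alpha>)"
  defines "w \<equiv> tensor [twisted_flip \<beta> ** twisted_flip \<alpha>]"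
  shows "(1/2) *\<^sub>R (x + w * x * adj w) \<in> spin_algebra (phase_hadamard \<beta>)"
proof -
  obtain K where K: "\<And>k. k \<ge> K \<Longrightarrow> x * flip_chain \<alpha> k = flip_chain \<alpha> k * x"
    using assms(1) unfolding spin_algebra_iff by blast
  have w: "adj w * w = 1"
    by (simp add: w_def adj_twisted_flip_product twisted_flip_product_unitary)
  have "((1/2) *\<^sub>R (x + w * x * adj w)) * flip_chain \<beta> k
      = flip_chain \<beta> k * ((1/2) *\<^sub>R (x + w * x * adj w))" if "k \<ge> K" for k
  proof -
    let ?F = "flip_chain \<beta> k" and ?y = "w * x * adj w"
    have F: "?F = w * flip_chain \<alpha> k"
      by (simp add: w_def flip_chain_change[of \<beta> k \<alpha>])
    have "?y * ?F = w * x * (adj w * w) * flip_chain \<alpha> k"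
      by (simp only: F mult.assoc)
    also have "\<dots> = w * (x * flip_chain \<alpha> k)"
      by (simp add: w mult.assoc)
    also have "\<dots> = ?F * x"
      by (simp only: K[OF that] F mult.assoc)
    finally have yF: "?y * ?F = ?F * x" .
    have "?F * ?y = ?F * (?y * ?F) * ?F"
      by (simp add: mult.assoc flip_chain_square)
    also have "\<dots> = (?F * ?F) * x * ?F"
      by (subst yF) (simp only: mult.assoc)
    finally have "?F * ?y = x * ?F" by (simp add: flip_chain_square)
    with yF show ?thesis
      by (simp add: scaleR_eq_cscale cscale_mult_left cscale_mult_right distrib_left distrib_right
          add.commute)
  qed
  then show ?thesis unfolding spin_algebra_iff by blast
qed

text \<open>
  The product is \<open>diag(e\<^sup>-\<^sup>i\<^sup>\<phi>, e\<^sup>i\<^sup>\<phi>)\<close> with \<open>\<phi> = \<alpha> - \<beta>\<close>.  The unitary \<open>diag(-i, i)\<close> that accompanies the sine is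
  itself a product of two twisted flips.
\<close>

lemma twisted_flip_product_decompose:
  "tensor [twisted_flip \<alpha> ** twisted_flip \<beta>]
    = cos (\<alpha> - \<beta>) *\<^sub>R 1 + sin (\<alpha> - \<beta>) *\<^sub>R tensor [twisted_flip (pi/2) ** twisted_flip 0]"
proof -
  have "twisted_flip \<alpha> ** twisted_flip \<beta>
      = cos (\<alpha> - \<beta>) *\<^sub>R mat 1 + sin (\<alpha> - \<beta>) *\<^sub>R (twisted_flip (pi/2) ** twisted_flip 0)"
    unfolding twisted_flip_mult
    by (auto simp: vec_eq_iff forall_2 mat_def complex_eq_iff sin_diff cos_diff)
  then show ?thesis
    by (simp add: tensor_single_scaleR flip: tensor_single_add tensor_single_one)
qed

abbreviation spin_factor :: "real \<Rightarrow> (2 gns \<Rightarrow>\<^sub>L 2 gns) set"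
  where "spin_factor \<theta> \<equiv> spin_subfactor (phase_hadamard \<theta>)"

lemma spin_factor_bounded: "T \<in> spin_factor \<theta> \<Longrightarrow> T \<in> bounded_operators"
  using closure_of_subset_topspace[of weak_operator_topology]
  by (auto simp: spin_subfactor_eq topspace_weak_operator_topology)

text \<open>
  For the average \<open>S\<close> of \<open>T\<close> and \<open>w T w\<^sup>*\<close>, the difference \<open>T - S\<close> is half of \<open>w [w\<^sup>*, T]\<close>.  Since \<open>w\<^sup>*\<close>
  is a scalar plus \<open>sin (\<alpha> - \<beta>) J\<close> with \<open>J\<close> unitary, the commutator has norm at most
  \<open>2 \<bar>sin (\<alpha> - \<beta>)\<bar>\<close>.
\<close>

lemma spin_factor_near:
  assumes "T \<in> op_ball (spin_factor \<alpha>)"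
  shows "\<exists>S \<in> op_ball (spin_factor \<beta>). trace_norm (T - S) \<le> \<bar>sin (\<alpha> - \<beta>)\<bar>"
proof -
  have T: "T \<in> spin_factor \<alpha>" "norm T \<le> 1" using assms by (auto simp: op_ball_def)
  define w where "w = tensor [twisted_flip \<beta> ** twisted_flip \<alpha>]"
  define J where "J = gns_rep (tensor [twisted_flip (pi/2) ** twisted_flip 0])"
  define S where "S = (1/2) *\<^sub>R (T + (gns_rep w o\<^sub>L T o\<^sub>L gns_rep (adj w)))"
  have S: "S \<in> spin_factor \<beta>"
    using conjugation_average_weak_closure[OF conjugation_average_spin_algebra
        T(1)[unfolded spin_subfactor_eq]]
    by (simp add: S_def w_def spin_subfactor_eq)
  have unit: "adj w * w = 1" "w * adj w = 1"
    by (simp_all add: w_def adj_twisted_flip_product twisted_flip_product_unitary)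
  have nw: "norm (gns_rep w \<xi>) = norm \<xi>" "norm (gns_rep (adj w) \<xi>) = norm \<xi>" for \<xi>
    using unit by (simp_all add: norm_gns_rep_apply adj_adj)
  have nJ: "norm (J \<xi>) = norm \<xi>" for \<xi>
    unfolding J_def by (intro norm_gns_rep_apply)
      (simp add: adj_twisted_flip_product twisted_flip_product_unitary)
  have nT: "norm (T \<xi>) \<le> norm \<xi>" for \<xi>
    using norm_blinfun[of T \<xi>] mult_right_mono[OF T(2), of "norm \<xi>"] by simp
  have "norm S \<le> 1"
  proof (rule norm_blinfun_bound)
    fix \<xi>
    have "norm (S \<xi>) = norm (T \<xi> + gns_rep w (T (gns_rep (adj w) \<xi>))) / 2"
      by (simp add: S_def blinfun.add_left blinfun.scaleR_left)
    also have "\<dots> \<le> (norm \<xi> + norm \<xi>) / 2"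
      using nT[of "gns_rep (adj w) \<xi>"]
      by (intro divide_right_mono norm_triangle_mono nT) (simp_all add: nw)
    finally show "norm (S \<xi>) \<le> 1 * norm \<xi>" by simp
  qed simp
  with S have "S \<in> op_ball (spin_factor \<beta>)" by (simp add: op_ball_def)
  moreover have "trace_norm (T - S) \<le> \<bar>sin (\<alpha> - \<beta>)\<bar>"
  proof -
    let ?\<xi> = "T gns_vec" and ?\<eta> = "T (gns_rep (adj w) gns_vec)"
    have rot: "gns_rep (adj w) \<xi> = cos (\<alpha> - \<beta>) *\<^sub>R \<xi> + sin (\<alpha> - \<beta>) *\<^sub>R J \<xi>" for \<xi>
      by (simp add: w_def adj_twisted_flip_product twisted_flip_product_decompose[of \<alpha> \<beta>]
          gns_rep_add gns_rep_scaleR gns_rep_one J_def blinfun.add_left blinfun.scaleR_left)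
    have "T gns_vec - S gns_vec = (1/2) *\<^sub>R (?\<xi> - gns_rep w ?\<eta>)"
      by (simp add: S_def blinfun.add_left blinfun.scaleR_left algebra_simps flip: scaleR_add_left)
    then have "trace_norm (T - S) = norm (?\<xi> - gns_rep w ?\<eta>) / 2"
      using trace_norm_diff[OF spin_factor_bounded[OF T(1)] spin_factor_bounded[OF S]] by simp
    also have "\<dots> = norm (gns_rep (adj w) (?\<xi> - gns_rep w ?\<eta>)) / 2"
      by (simp add: nw)
    also have "gns_rep (adj w) (gns_rep w ?\<eta>) = ?\<eta>"
      using unit(1) by (metis blinfun_apply_blinfun_compose gns_rep_mult gns_rep_one
          blinfun_apply_id_blinfun id_apply)
    then have "gns_rep (adj w) (?\<xi> - gns_rep w ?\<eta>) = sin (\<alpha> - \<beta>) *\<^sub>R (J ?\<xi> - T (J gns_vec))"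
      by (simp add: blinfun.diff_right rot blinfun.add_right blinfun.scaleR_right scaleR_diff_right)
    also have "norm \<dots> / 2 \<le> \<bar>sin (\<alpha> - \<beta>)\<bar> * (1 + 1) / 2"
    proof -
      have "norm (J ?\<xi> - T (J gns_vec)) \<le> norm (J ?\<xi>) + norm (T (J gns_vec))"
        by (rule norm_triangle_ineq4)
      also have "\<dots> \<le> 1 + 1"
        using nT[of gns_vec] nT[of "J gns_vec"] by (intro add_mono) (simp_all add: nJ norm_gns_vec)
      finally show ?thesis by (simp add: mult_left_mono)
    qed
    finally show ?thesis by simp
  qed
  ultimately show ?thesis by blast
qed

text \<open>
  A quarter turn of the angle makes two twisted flips anticommute.
\<close>

lemma flip_chain_anticommutes:
  "flip_chain \<theta> k * tensor [twisted_flip (\<theta> + pi/2)]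
    = - (tensor [twisted_flip (\<theta> + pi/2)] * flip_chain \<theta> k)"
proof (induction k)
  case 0
  have "twisted_flip \<theta> ** twisted_flip (\<theta> + pi/2) = - (twisted_flip (\<theta> + pi/2) ** twisted_flip \<theta>)"
    by (auto simp: twisted_flip_mult vec_eq_iff forall_2 complex_eq_iff)
  then show ?case by (simp add: tensor_single_mult tensor_single_uminus)
next
  case (Suc k)
  let ?z = "tensor [twisted_flip (\<theta> + pi/2)]" and ?X = "(shift ^^ Suc k) (tensor [twisted_flip 0])"
  have "flip_chain \<theta> k * ?X * ?z = flip_chain \<theta> k * ?z * ?X"
    by (simp only: mult.assoc level_commute_shift[OF tensor_single_level])
  then show ?case
    by (simp add: Suc.IH mult.assoc del: funpow.simps)
qed

text \<open>
  The trace is invariant under conjugation by the chain, which fixes \<open>x\<close> and changes the sign of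
  the other factor.
\<close>

lemma spin_algebra_orthogonal:
  assumes "x \<in> spin_algebra (phase_hadamard \<theta>)"
  shows "trc (tensor [twisted_flip (\<theta> + pi/2)] * x) = 0"
proof -
  obtain k where k: "x * flip_chain \<theta> k = flip_chain \<theta> k * x"
    using assms unfolding spin_algebra_iff by blast
  let ?z = "tensor [twisted_flip (\<theta> + pi/2)]" and ?F = "flip_chain \<theta> k"
  have "trc (?z * x) = trc (?F * (?F * ?z * x))"
    by (simp add: flip_chain_square flip: mult.assoc)
  also have "\<dots> = trc (?F * ?z * (x * ?F))"
    by (simp only: trc_mult_commute[of ?F] mult.assoc)
  also have "?F * ?z * (x * ?F) = - (?z * (?F * ?F) * x)"
    by (simp add: k flip_chain_anticommutes mult.assoc)
  finally show ?thesis by (simp add: flip_chain_square trc_uminus)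
qed

lemma twisted_flip_in_op_ball: "gns_rep (tensor [twisted_flip \<theta>]) \<in> op_ball (spin_factor \<theta>)"
proof -
  have "tensor [twisted_flip \<theta>] * flip_chain \<theta> k = flip_chain \<theta> k * tensor [twisted_flip \<theta>]" for k
  proof (induction k)
    case (Suc k)
    let ?X = "(shift ^^ Suc k) (tensor [twisted_flip 0])"
    have "tensor [twisted_flip \<theta>] * (flip_chain \<theta> k * ?X)
        = flip_chain \<theta> k * (tensor [twisted_flip \<theta>] * ?X)"
      by (simp only: Suc.IH flip: mult.assoc)
    then show ?case
      by (simp add: level_commute_shift[OF tensor_single_level] mult.assoc del: funpow.simps)
  qed simp
  then have "tensor [twisted_flip \<theta>] \<in> spin_algebra (phase_hadamard \<theta>)"
    by (simp add: spin_algebra_iff)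
  moreover have "gns_rep ` spin_algebra u \<subseteq> spin_subfactor u" for u :: "complex^2^2"
    unfolding spin_subfactor_eq
    by (rule closure_of_subset)
       (auto simp: topspace_weak_operator_topology gns_rep_bounded_operators)
  ultimately have "gns_rep (tensor [twisted_flip \<theta>]) \<in> spin_factor \<theta>" by blast
  moreover have "norm (gns_rep (tensor [twisted_flip \<theta>])) \<le> 1"
    by (rule norm_gns_rep_le)
       (simp add: adj_tensor_single matrix_adj_twisted_flip tensor_twisted_flip_square)
  ultimately show ?thesis by (simp add: op_ball_def)
qed

text \<open>
  A unit vector orthogonal to \<open>S\<close> bounds the distance from below by Cauchy--Schwarz.
\<close>

lemma twisted_flip_far:
  assumes "S \<in> spin_factor \<beta>"
  shows "\<bar>sin (\<alpha> - \<beta>)\<bar> \<le> trace_norm (gns_rep (tensor [twisted_flip \<alpha>]) - S)"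
proof -
  let ?z = "tensor [twisted_flip (\<beta> + pi/2)]" and ?x = "tensor [twisted_flip \<alpha>]"
  let ?\<zeta> = "gns_rep ?z gns_vec"
  have adj_z: "adj ?z = ?z" by (simp add: adj_tensor_single matrix_adj_twisted_flip)
  have pairing: "cinner (gns_rep a gns_vec) ?\<zeta> = trc (?z * a)" for a
    by (simp add: gns_vec_def gns_rep_embed cinner_embed adj_z)
  have S0: "cinner (S gns_vec) ?\<zeta> = 0"
    using assms unfolding spin_subfactor_eq
    by (rule weak_closure_eqI) (auto simp: pairing spin_algebra_orthogonal)
  have "trc (?z * ?x) = of_real (sin (\<alpha> - \<beta>))"
    by (simp add: tensor_single_mult trc_tensor_single twisted_flip_mult trace_def sum_2 complex_eq_iff
        sin_diff cos_diff cos_add sin_add)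
  then have "inner (gns_rep ?x gns_vec) ?\<zeta> = sin (\<alpha> - \<beta>)"
    using pairing[of ?x] by (simp add: cinner_def complex_eq_iff)
  moreover have "inner (S gns_vec) ?\<zeta> = 0"
    using S0 by (simp add: cinner_def complex_eq_iff)
  ultimately have "sin (\<alpha> - \<beta>) = inner (gns_rep ?x gns_vec - S gns_vec) ?\<zeta>"
    by (simp add: inner_diff_left)
  moreover have "norm ?\<zeta> = 1"
    using norm_gns_rep_apply[of ?z] by (simp add: adj_z tensor_twisted_flip_square norm_gns_vec)
  ultimately have "\<bar>sin (\<alpha> - \<beta>)\<bar> \<le> norm (gns_rep ?x gns_vec - S gns_vec)"
    using Cauchy_Schwarz_ineq2[of "gns_rep ?x gns_vec - S gns_vec" ?\<zeta>] by simp
  then show ?thesis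
    by (simp add: trace_norm_diff gns_rep_bounded_operators spin_factor_bounded[OF assms])
qed

lemma trace_norm_commute:
  assumes "S \<in> op_ball (spin_factor \<alpha>)" "T \<in> op_ball (spin_factor \<beta>)"
  shows "trace_norm (S - T) = trace_norm (T - S)"
proof -
  have "S \<in> bounded_operators" "T \<in> bounded_operators"
    using assms spin_factor_bounded by (auto simp: op_ball_def)
  then show ?thesis by (simp add: trace_norm_diff norm_minus_commute)
qed

lemma one_sided_distance:
  "(SUP T\<in>op_ball (spin_factor \<alpha>). INF S\<in>op_ball (spin_factor \<beta>). trace_norm (T - S))
    = \<bar>sin (\<alpha> - \<beta>)\<bar>"
proof (rule antisym)
  have upper: "(INF S\<in>op_ball (spin_factor \<beta>). trace_norm (T - S)) \<le> \<bar>sin (\<alpha> - \<beta>)\<bar>"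
    if T: "T \<in> op_ball (spin_factor \<alpha>)" for T
  proof -
    obtain S where S: "S \<in> op_ball (spin_factor \<beta>)" "trace_norm (T - S) \<le> \<bar>sin (\<alpha> - \<beta>)\<bar>"
      using spin_factor_near[OF T] by blast
    have "bdd_below ((\<lambda>S. trace_norm (T - S)) ` op_ball (spin_factor \<beta>))"
      using T by (intro bdd_belowI2[of _ 0])
        (auto simp: op_ball_def trace_norm_diff spin_factor_bounded)
    then have "(INF S\<in>op_ball (spin_factor \<beta>). trace_norm (T - S)) \<le> trace_norm (T - S)"
      using S(1) by (rule cINF_lower)
    with S(2) show ?thesis by linarith
  qed
  show "(SUP T\<in>op_ball (spin_factor \<alpha>). INF S\<in>op_ball (spin_factor \<beta>). trace_norm (T - S))
      \<le> \<bar>sin (\<alpha> - \<beta>)\<bar>"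
    using twisted_flip_in_op_ball[of \<alpha>] by (intro cSUP_least upper) auto
  have "\<bar>sin (\<alpha> - \<beta>)\<bar> \<le> (INF S\<in>op_ball (spin_factor \<beta>).
      trace_norm (gns_rep (tensor [twisted_flip \<alpha>]) - S))"
    using twisted_flip_in_op_ball[of \<beta>] by (intro cINF_greatest twisted_flip_far) (auto simp: op_ball_def)
  also have "\<dots> \<le> (SUP T\<in>op_ball (spin_factor \<alpha>).
      INF S\<in>op_ball (spin_factor \<beta>). trace_norm (T - S))"
    using upper by (intro cSUP_upper twisted_flip_in_op_ball bdd_aboveI2)
  finally show "\<bar>sin (\<alpha> - \<beta>)\<bar> \<le> (SUP T\<in>op_ball (spin_factor \<alpha>).
      INF S\<in>op_ball (spin_factor \<beta>). trace_norm (T - S))" .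
qed

text \<open>
  The two one-sided distances agree because \<open>\<bar>sin\<bar>\<close> is even.
\<close>

lemma mt_distance_spin_factor:
  "mt_distance (spin_factor \<alpha>) (spin_factor \<beta>) = \<bar>sin (\<alpha> - \<beta>)\<bar>"
proof -
  have "(SUP S\<in>op_ball (spin_factor \<beta>). INF T\<in>op_ball (spin_factor \<alpha>). trace_norm (T - S))
      = (SUP S\<in>op_ball (spin_factor \<beta>). INF T\<in>op_ball (spin_factor \<alpha>). trace_norm (S - T))"
    by (intro SUP_cong INF_cong refl trace_norm_commute)
  also have "\<dots> = \<bar>sin (\<alpha> - \<beta>)\<bar>"
    unfolding one_sided_distance using sin_minus[of "\<alpha> - \<beta>"] by simp
  finally show ?thesis
    by (simp add: mt_distance_def one_sided_distance)
qed

theorem corollary3p17: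
  fixes r :: real
  assumes "r \<in> {0..1}"
  shows "\<exists>u v :: complex^2^2. hadamard_unitary u \<and> hadamard_unitary v \<and>
    mt_distance (spin_subfactor u) (spin_subfactor v) = r"
proof -
  have "mt_distance (spin_factor (arcsin r)) (spin_factor 0) = r"
    using assms by (simp add: mt_distance_spin_factor)
  then show ?thesis
    using hadamard_unitary_phase_hadamard by blast
qed

end
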